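(* (1) For every $d\in\mathbb{N}$ with $3\le d\le 8$, every $n\in\mathbb{N}_0$ can be represented as $n=t_x+t_y+3t_z+d\,t_w$ for some $x,y,z,w\in\mathbb{N}_0$. (2) Let $a,b,c,d$ be positive integers with $a\le b\le c\le d$. Then every $n\in\mathbb{N}_0$ can be written as $n=a t_x+b t_y+c t_z+d t_w$ for some $x,y,z,w\in\mathbb{N}_0$ if and only if $(a,b,c,d)$ is among the following vectors (where in the first seven families $d$ is arbitrary subject to $c\le d$): $$(1,1,1,d),\ (1,1,2,d),\ (1,1,4,d),\ (1,1,5,d),\ (1,2,2,d),\ (1,2,3,d),\ (1,2,4,d),$$ $$(1,1,3,3),\ (1,1,3,4),\ (1,1,3,5),\ (1,1,3,6),\ (1,1,3,7),\ (1,1,3,8).$$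
   Context: $\mathbb{N}=\{1,2,3,\ldots\}$ and $\mathbb{N}_0=\{0,1,2,\ldots\}$. For $x\in\mathbb{N}_0$, $t_x=x(x+1)/2$ denotes the $x$-th triangular number. *)

theory Defs
  imports Complex_Main "HOL-Library.Nat_Bijection"
begin

(* The triangular number t_x = x(x+1)/2 is the library's triangle x = x * Suc x div 2;
   the division is exact, since x * Suc x is even. *)

definition represents :: "nat \<Rightarrow> nat \<Rightarrow> nat \<Rightarrow> nat \<Rightarrow> nat \<Rightarrow> bool" where
  "represents a b c d n \<longleftrightarrow>
     (\<exists>x y z w :: nat. n = a * triangle x + b * triangle y + c * triangle z + d * triangle w)"

end

theory Submission
  imports Defs "HOL-Number_Theory.Number_Theory" "HOL-Computational_Algebra.Squarefree"
    "HOL-Library.Discrete_Functions"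
begin

text \<open>
  Gauss's three-square theorem settles all seven universal ternary forms
  $(1,1,1), (1,1,2), (1,1,4), (1,1,5), (1,2,2), (1,2,3), (1,2,4)$: completing squares turns them into
  diagonal forms in odd variables, which are rationally similar to $x^2+y^2+z^2$, and explicit
  similarities transport a suitable representation as a sum of three squares. The form $(1,1,3)$ is
  not of this type. It represents every $n$ with $n \bmod 3 \neq 2$; the remaining $n$ are reached with
  $w = 1$ if $d = 7, 8$; if $d = 3, 6$, the identity $t_{3x+1} = 9 t_x + 1$ reduces $n = 3k + 2$ to the
  representation of $k$ by $(1,1,3,3)$ or $(1,2,3)$.

  For both $x^2+y^2+z^2$ and $x^2+y^2+yz+z^2$, an integer $N$ is first represented rationally as
  $z^2 + Q t^2$, where $Q$ is a prime (or twice a prime) that is a value of the binary part and is chosen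
  such that $-Q$ is a square modulo $N$ and $N$ is a square modulo $Q$; a pigeonhole argument then yields
  the rational representation, and the descent of Davenport and Cassels makes it integral. The prime
  exists because only finitely many real characters are prescribed, so that Dirichlet's method
  needs nothing beyond $L(1,\chi) \neq 0$ for real $\chi$.
\<close>

section \<open>Sums of the von Mangoldt function\<close>

text \<open>Primes in a given residue class would require complex characters. Fixing the signs of
  finitely many real characters requires only their products: the product of the factors
  \<open>1 + \<epsilon> i * \<chi> i d\<close> detects the pattern and expands into them.

  The form (1,1,3) escapes the similarity argument because x^2 + y^2 + 3z^2 is anisotropic over the
  3-adic numbers, where the sum of three squares is isotropic. The excluded class n mod 3 = 2 is the
  one in which 8n + 5 is divisible by 3. The descent does not apply to x^2 + y^2 + 3z^2 directly
  either: rounding may leave 1/4 + 1/4 + 3/4 > 1. For x^2 + y^2 + yz + z^2, a form on a lattice that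
  contains the former one with index 2, it leaves at most 1/4 + 1/4 + 3/16.\<close>

lemma sum_divisors_swap:
  fixes g :: "nat \<Rightarrow> nat \<Rightarrow> real"
  shows "(\<Sum>n=1..x. \<Sum>d | d dvd n. g d (n div d)) = (\<Sum>d=1..x. \<Sum>m=1..x div d. g d m)"
proof -
  have "(\<Sum>n=1..x. \<Sum>d | d dvd n. g d (n div d))
      = (\<Sum>(n, d)\<in>(SIGMA n:{1..x}. {d. d dvd n}). g d (n div d))"
    by (rule sum.Sigma) auto
  also have "\<dots> = (\<Sum>(d, m)\<in>(SIGMA d:{1..x}. {1..x div d}). g d m)"
  proof (rule sum.reindex_bij_witness[of _ "\<lambda>(d, m). (d * m, d)" "\<lambda>(n, d). (d, n div d)"], goal_cases)
    case (2 a)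
    then obtain n d where a: "a = (n, d)" "1 \<le> n" "n \<le> x" "d dvd n" by auto
    then obtain m where "n = d * m" by auto
    with a show ?case
      by (auto simp: less_eq_div_iff_mult_less_eq mult.commute Suc_le_eq)
         (metis dvd_imp_le dvd_triv_left le_trans mult_pos_pos)
  next
    case (4 b)
    then show ?case
      by (auto simp: less_eq_div_iff_mult_less_eq mult.commute Suc_le_eq)
  qed auto
  also have "\<dots> = (\<Sum>d=1..x. \<Sum>m=1..x div d. g d m)"
    by (rule sum.Sigma[symmetric]) auto
  finally show ?thesis .
qed

text \<open>Summation by parts: the differences \<open>f n - f (Suc n)\<close> are nonnegative and
  telescope to \<open>f a - f b\<close>; together with the boundary term, at most
  \<open>C * f b\<close>, they leave \<open>C * f a\<close>.\<close>

lemma abs_sum_mult_antimono_le: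
  fixes f g :: "nat \<Rightarrow> real"
  assumes G: "\<And>b. \<bar>\<Sum>n=a..<b. g n\<bar> \<le> C"
    and mono: "\<And>n. a \<le> n \<Longrightarrow> f (Suc n) \<le> f n" and nonneg: "\<And>n. a \<le> n \<Longrightarrow> 0 \<le> f n"
  shows "\<bar>\<Sum>n=a..<b. g n * f n\<bar> \<le> C * f a"
proof -
  define G where "G = (\<lambda>b. \<Sum>n=a..<b. g n)"
  have C: "0 \<le> C" using G[of a] by simp
  show ?thesis
  proof (cases "a \<le> b")
    case False
    then show ?thesis using C nonneg[of a] by simp
  next
    case True
    have "(\<Sum>n=a..<b. g n * f n) = G b * f b + (\<Sum>n=a..<b. G (Suc n) * (f n - f (Suc n)))"
      using True
    proof (induction b rule: dec_induct)
      case base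
      then show ?case by (simp add: G_def)
    next
      case (step b)
      have "G (Suc b) = G b + g b" using step by (simp add: G_def)
      then show ?case using step by (simp add: algebra_simps)
    qed
    moreover have "\<bar>G b * f b\<bar> \<le> C * f b"
      using G[of b] nonneg[OF True] by (simp add: G_def abs_mult mult_right_mono)
    moreover have "\<bar>\<Sum>n=a..<b. G (Suc n) * (f n - f (Suc n))\<bar> \<le> (\<Sum>n=a..<b. C * (f n - f (Suc n)))"
      unfolding G_def
    proof (intro order_trans[OF sum_abs] sum_mono)
      fix n assume n: "n \<in> {a..<b}"
      show "\<bar>(\<Sum>n=a..<Suc n. g n) * (f n - f (Suc n))\<bar> \<le> C * (f n - f (Suc n))"
        unfolding abs_mult using mult_mono[OF G[of "Suc n"] order_refl, of "f n - f (Suc n)"] mono[of n] C n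
        by simp
    qed
    moreover have "(\<Sum>n=a..<b. C * (f n - f (Suc n))) = C * (f a - f b)"
      using sum_Suc_diff'[OF True, of "\<lambda>n. - f n"]
      by (simp add: sum_distrib_left[symmetric])
    ultimately show ?thesis by (simp add: algebra_simps)
  qed
qed

section \<open>Harmonic divergence and Chebyshev's upper bound\<close>

lemma ln_le_harmonic: "ln (real (Suc M)) \<le> (\<Sum>k=1..M. 1 / real k)"
proof (induction M)
  case (Suc M)
  have "ln (real (Suc (Suc M))) - ln (real (Suc M)) = ln (1 + 1 / real (Suc M))"
  proof -
    have "1 + 1 / real (Suc M) = real (Suc (Suc M)) / real (Suc M)" by (simp add: field_simps)
    then show ?thesis by (simp only: ln_div) simp
  qed
  also have "\<dots> \<le> 1 / real (Suc M)"
    by (intro ln_add_one_self_le_self) auto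
  finally show ?case using Suc by simp
qed auto

lemma harmonic_unbounded: "\<exists>M. B < (\<Sum>k=1..M. 1 / real k)"
proof -
  obtain M where "exp B < real M" using reals_Archimedean2 by blast
  then have "B < ln (real (Suc M))"
    using ln_less_cancel_iff[of "exp B" "real (Suc M)"] by simp
  also note ln_le_harmonic
  finally show ?thesis by blast
qed

text \<open>Chebyshev's argument: \<open>ln (fact x)\<close> is the sum of
  \<open>mangoldt d * real (x div d)\<close>, so the logarithm of the central binomial coefficient
  weights each \<open>mangoldt d\<close> with \<open>2 * n div d - 2 * (n div d)\<close>. This
  weight is nonnegative, and at least 1 for n < d \<le> 2n.\<close>

lemma sum_mangoldt_double:
  "(\<Sum>d=1..2*n. mangoldt d) \<le> (\<Sum>d=1..n. mangoldt d) + 2 * real n * ln 2"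
proof (cases "n = 0")
  case False
  have T: "ln (fact x) = (\<Sum>d=1..x. mangoldt d * real (x div d))" for x :: nat
  proof -
    have "ln (fact x :: real) = (\<Sum>n=1..x. ln (real n))"
      unfolding fact_prod by (subst of_nat_prod) (subst ln_prod, auto)
    also have "\<dots> = (\<Sum>n=1..x. \<Sum>d | d dvd n. mangoldt d)"
      by (intro sum.cong refl) (subst mangoldt_sum, auto)
    also have "\<dots> = (\<Sum>d=1..x. mangoldt d * real (x div d))"
      using sum_divisors_swap[of "\<lambda>d m. mangoldt d" x] by (simp add: mult.commute)
    finally show ?thesis .
  qed
  have T2: "(\<Sum>d=1..2*n. mangoldt d * real (n div d)) = (ln (fact n) :: real)"
    unfolding T by (intro sum.mono_neutral_right) auto
  have "(\<Sum>d=1..2*n. mangoldt d) - (\<Sum>d=1..n. mangoldt d) = (\<Sum>d\<in>{1..2*n} - {1..n}. mangoldt d :: real)"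
    by (rule sum_diff[symmetric]) auto
  also have "\<dots> = (\<Sum>d=1..2*n. if n < d then mangoldt d else 0)"
    by (intro sum.mono_neutral_cong_left) auto
  also have "\<dots> \<le> (\<Sum>d=1..2*n. mangoldt d * (real (2 * n div d) - 2 * real (n div d)))"
  proof (intro sum_mono)
    fix d assume d: "d \<in> {1..2*n}"
    have "(if n < d then 1 else 0) + 2 * (n div d) \<le> 2 * n div d"
    proof -
      have "2 * (n div d) \<le> 2 * n div d"
        using d by (simp add: less_eq_div_iff_mult_less_eq)
      moreover have "1 \<le> 2 * n div d"
        using d by (simp add: less_eq_div_iff_mult_less_eq)
      ultimately show ?thesis by auto
    qed
    then have "(if n < d then 1 else 0) \<le> real (2 * n div d) - 2 * real (n div d)"
      by (auto split: if_splits simp del: of_nat_mult simp add: of_nat_mult[symmetric])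
    from mult_left_mono[OF this mangoldt_nonneg[of d]]
    show "(if n < d then mangoldt d else 0) \<le> mangoldt d * (real (2 * n div d) - 2 * real (n div d))"
      by (auto split: if_splits)
  qed
  also have "\<dots> = ln (fact (2 * n)) - 2 * ln (fact n)"
    unfolding T[of "2*n"] T2[symmetric] by (simp add: right_diff_distrib sum_subtractf sum_distrib_left mult_ac)
  also have "\<dots> = ln (real (2 * n choose n))"
    using binomial_fact[of n "2 * n", where ?'a = real] by (simp add: ln_div ln_mult)
  also have "\<dots> \<le> ln (2 ^ (2 * n))"
  proof -
    have "real (2 * n choose n) \<le> real (2 ^ (2 * n))"
      by (intro of_nat_mono binomial_le_pow2)
    then show ?thesis by (subst ln_le_cancel_iff) (simp_all add: zero_less_binomial)
  qed
  also have "\<dots> = 2 * real n * ln 2" by (simp add: ln_realpow)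
  finally show ?thesis by simp
qed auto

text \<open>Iterated halving. For \<open>n = 2 * k + 1\<close> the sum is enlarged to
  \<open>2 * (k + 1)\<close>; the constant 4 absorbs this because 6k + 6 \<le> 8k + 4 once k \<ge>
  1.\<close>

lemma sum_mangoldt_le: "(\<Sum>d=1..n. mangoldt d) \<le> 4 * ln 2 * real n"
proof (induction n rule: less_induct)
  case (less n)
  consider "n = 0" | "n = 1" | k where "n = 2 * k" "k \<ge> 1" | k where "n = 2 * k + 1" "k \<ge> 1"
    by (metis Suc_eq_plus1 Suc_leI add_0 evenE mult_0_right nat_neq_iff not_gr_zero oddE)
  then show ?case
  proof cases
    case (3 k)
    have "(\<Sum>d=1..n. mangoldt d) \<le> 4 * ln 2 * real k + 2 * real k * ln 2"
      unfolding 3(1) using order_trans[OF sum_mangoldt_double[of k] add_right_mono[OF less[of k]]] 3 by simp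
    also have "\<dots> = ln 2 * (6 * real k)" by simp
    also have "\<dots> \<le> ln 2 * (4 * real n)" using 3 by (intro mult_left_mono) auto
    finally show ?thesis by simp
  next
    case (4 k)
    have "(\<Sum>d=1..n. mangoldt d) \<le> (\<Sum>d=1..2*(k+1). mangoldt d :: real)"
      using 4 by (intro sum_mono2) (auto simp: mangoldt_nonneg)
    also have "\<dots> \<le> 4 * ln 2 * real (k + 1) + 2 * real (k + 1) * ln 2"
      using less[of "k+1"] sum_mangoldt_double[of "k+1"] 4 by simp
    also have "\<dots> = ln 2 * (6 * real k + 6)" by (simp add: algebra_simps)
    also have "\<dots> \<le> ln 2 * (4 * real n)" using 4 by (intro mult_left_mono) auto
    finally show ?thesis by simp
  qed auto
qed

section \<open>Real characters and the value $L(1,\chi)$\<close>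

text \<open>A nonprincipal real Dirichlet character: the vanishing sum over a period excludes the
  principal one and is the source of all cancellation estimates below.\<close>

locale real_character =
  fixes \<chi> :: "nat \<Rightarrow> real" and K :: nat
  assumes K: "0 < K"
    and mult: "\<chi> (a * b) = \<chi> a * \<chi> b"
    and periodic: "\<chi> (a + K) = \<chi> a"
    and range: "\<chi> a \<in> {-1, 0, 1}"
    and one: "\<chi> 1 = 1"
    and sum_period: "(\<Sum>a<K. \<chi> a) = 0"
begin

lemma abs_le_1: "\<bar>\<chi> a\<bar> \<le> 1"
  using range[of a] by auto

lemma abs_sum_lessThan: "\<bar>\<Sum>n<b. \<chi> n\<bar> \<le> real K"
proof (induction b rule: less_induct)
  case (less b)
  show ?case
  proof (cases "b < K")
    case True
    have "\<bar>\<Sum>n<b. \<chi> n\<bar> \<le> (\<Sum>n<b. 1)"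
      by (intro order_trans[OF sum_abs] sum_mono abs_le_1)
    with True show ?thesis by simp
  next
    case False
    define c where "c = b - K"
    have b: "b = K + c" using False by (simp add: c_def)
    have "(\<Sum>n<b. \<chi> n) = (\<Sum>n<K. \<chi> n) + (\<Sum>n<c. \<chi> (n + K))"
      unfolding b by (subst lessThan_atLeast0, subst sum.atLeastLessThan_concat[symmetric, of 0 K "K + c"])
        (use sum.shift_bounds_nat_ivl[of \<chi> 0 K c] in \<open>auto simp: lessThan_atLeast0 add.commute\<close>)
    then have "(\<Sum>n<b. \<chi> n) = (\<Sum>n<c. \<chi> n)" by (simp add: sum_period periodic)
    then show ?thesis using less[of c] b K by simp
  qed
qed

lemma abs_sum: "\<bar>\<Sum>n=a..<b. \<chi> n\<bar> \<le> 2 * real K"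
proof (cases "a \<le> b")
  case True
  have "(\<Sum>n=a..<b. \<chi> n) = (\<Sum>n<b. \<chi> n) - (\<Sum>n<a. \<chi> n)"
    using sum.atLeastLessThan_concat[of 0 a b \<chi>] True by (simp add: lessThan_atLeast0)
  then show ?thesis using abs_sum_lessThan[of a] abs_sum_lessThan[of b] by simp
qed auto

lemma abs_weighted_sum:
  assumes "\<And>n. a \<le> n \<Longrightarrow> f (Suc n) \<le> f n" "\<And>n. a \<le> n \<Longrightarrow> 0 \<le> f n"
  shows "\<bar>\<Sum>n=a..<b. \<chi> n * f n\<bar> \<le> 2 * real K * f a"
  using assms by (intro abs_sum_mult_antimono_le abs_sum)

lemma abs_weighted_sum_atLeastAtMost:
  assumes "\<And>n. a \<le> n \<Longrightarrow> f (Suc n) \<le> f n" "\<And>n. a \<le> n \<Longrightarrow> 0 \<le> f n"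
  shows "\<bar>\<Sum>n=a..b. \<chi> n * f n\<bar> \<le> 2 * real K * f a"
  using abs_weighted_sum[where a = a and f = f and b = "Suc b"] assms
  by (simp add: atLeastLessThanSuc_atLeastAtMost)

definition L :: real where "L = (\<Sum>n. \<chi> (Suc n) / real (Suc n))"

lemma summable_L: "summable (\<lambda>n. \<chi> (Suc n) / real (Suc n))"
proof (rule summable_Cauchy[THEN iffD2], intro allI impI)
  fix e :: real assume e: "0 < e"
  obtain N where N: "2 * real K / e < real N" using reals_Archimedean2 by blast
  show "\<exists>N. \<forall>m\<ge>N. \<forall>n. norm (\<Sum>k=m..<n. \<chi> (Suc k) / real (Suc k)) < e"
  proof (intro exI allI impI)
    fix m n assume "N \<le> m"
    have "(\<Sum>k=m..<n. \<chi> (Suc k) / real (Suc k)) = (\<Sum>k=Suc m..<Suc n. \<chi> k * (1 / real k))"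
      by (subst sum.shift_bounds_Suc_ivl) simp
    moreover have "\<bar>\<dots>\<bar> \<le> 2 * real K * (1 / real (Suc m))"
      by (rule abs_weighted_sum) (auto simp: field_simps)
    moreover have "2 * real K * (1 / real (Suc m)) < e"
    proof -
      have "2 * real K < e * real N" using N e by (simp add: field_simps)
      also have "\<dots> \<le> e * real (Suc m)" using e \<open>N \<le> m\<close> by (intro mult_left_mono) auto
      finally show ?thesis by (simp add: field_simps)
    qed
    ultimately show "norm (\<Sum>k=m..<n. \<chi> (Suc k) / real (Suc k)) < e" by simp
  qed
qed

lemma L_approx: "\<bar>(\<Sum>n=1..y. \<chi> n / real n) - L\<bar> \<le> 2 * real K / real (Suc y)"
proof -
  define S where "S = (\<lambda>b. \<Sum>n<b. \<chi> (Suc n) / real (Suc n))"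
  have S: "S b = (\<Sum>n=1..b. \<chi> n / real n)" for b
    unfolding S_def by (rule sum.reindex_bij_witness[of _ "\<lambda>n. n - 1" Suc]) auto
  have "S \<longlonglongrightarrow> L"
    unfolding S_def L_def using summable_L by (rule summable_LIMSEQ)
  then have lim: "(\<lambda>b. \<bar>S y - S b\<bar>) \<longlonglongrightarrow> \<bar>S y - L\<bar>"
    by (intro tendsto_intros)
  have "\<bar>S y - S b\<bar> \<le> 2 * real K / real (Suc y)" if "y \<le> b" for b
  proof -
    have "S b = S y + (\<Sum>n=Suc y..b. \<chi> n / real n)"
      unfolding S using that sum.ub_add_nat[of 1 y "\<lambda>n. \<chi> n / real n" "b - y"] by simp
    moreover have "\<bar>\<Sum>n=Suc y..b. \<chi> n * (1 / real n)\<bar> \<le> 2 * real K * (1 / real (Suc y))"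
      by (rule abs_weighted_sum_atLeastAtMost) (auto simp: field_simps)
    ultimately show ?thesis by simp
  qed
  then have "\<bar>S y - L\<bar> \<le> 2 * real K / real (Suc y)"
    by (intro tendsto_upperbound[OF lim]) (auto simp: eventually_sequentially)
  then show ?thesis by (simp only: S)
qed

lemma sum_ln_bounded: "\<exists>B. \<forall>x. \<bar>\<Sum>n=1..x. \<chi> n * ln (real n) / real n\<bar> \<le> B"
proof -
  define f where "f = (\<lambda>n. ln (real n) / real n)"
  \<comment> \<open>\<open>ln n / n\<close> decreases only beyond e < 3, so the terms with n < 3 are
    split off before the partial summation.\<close>
  have anti: "f (Suc n) \<le> f n" if "3 \<le> n" for n
  proof -
    have ln: "1 \<le> ln (real n)"
      using that exp_le by (subst ln_ge_iff) auto
    have "ln (real (Suc n)) \<le> ln (real n) + 1 / real n"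
    proof -
      have "ln (real (Suc n)) - ln (real n) = ln (1 + 1 / real n)"
      proof -
        have "1 + 1 / real n = real (Suc n) / real n" using that by (simp add: field_simps)
        then show ?thesis using that by (simp only: ln_div) simp
      qed
      also have "\<dots> \<le> 1 / real n" by (intro ln_add_one_self_le_self) auto
      finally show ?thesis by simp
    qed
    then have "ln (real (Suc n)) * real n \<le> (ln (real n) + 1 / real n) * real n"
      by (intro mult_right_mono) auto
    also have "\<dots> = ln (real n) * real n + 1"
      using that by (simp add: algebra_simps)
    finally have "ln (real (Suc n)) * real n \<le> ln (real n) * real n + 1" .
    with ln show ?thesis using that by (simp add: f_def divide_simps ring_distribs)
  qed
  have "\<bar>\<Sum>n=1..x. \<chi> n * f n\<bar> \<le> (\<Sum>n=1..<3. \<bar>f n\<bar>) + 2 * real K * f 3" for x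
  proof (cases "3 \<le> x")
    case True
    have "(\<Sum>n=1..x. \<chi> n * f n) = (\<Sum>n=1..<3. \<chi> n * f n) + (\<Sum>n=3..x. \<chi> n * f n)"
      using True sum.atLeastLessThan_concat[of 1 3 "Suc x" "\<lambda>n. \<chi> n * f n"]
      by (simp add: atLeastLessThanSuc_atLeastAtMost)
    moreover have "\<bar>\<Sum>n=1..<3. \<chi> n * f n\<bar> \<le> (\<Sum>n=1..<3. \<bar>f n\<bar>)"
      by (intro order_trans[OF sum_abs] sum_mono)
         (auto simp: abs_mult abs_le_1 mult_left_le_one_le)
    moreover have "\<bar>\<Sum>n=3..x. \<chi> n * f n\<bar> \<le> 2 * real K * f 3"
      by (rule abs_weighted_sum_atLeastAtMost) (use anti in \<open>auto simp: f_def\<close>)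
    ultimately show ?thesis by linarith
  next
    case False
    have "\<bar>\<Sum>n=1..x. \<chi> n * f n\<bar> \<le> (\<Sum>n=1..x. \<bar>f n\<bar>)"
      by (intro order_trans[OF sum_abs] sum_mono)
         (auto simp: abs_mult abs_le_1 mult_left_le_one_le)
    also have "\<dots> \<le> (\<Sum>n=1..<3. \<bar>f n\<bar>)"
      using False by (intro sum_mono2) auto
    moreover have "0 \<le> 2 * real K * f 3" by (simp add: f_def)
    ultimately show ?thesis by linarith
  qed
  then show ?thesis unfolding f_def by (auto simp: mult.assoc)
qed

end

text \<open>The expansion of \<open>ln n\<close> over the divisors of n factors by complete
  multiplicativity. It stands outside the locale because it is applied to the principal character
  too.\<close>

lemma sum_mangoldt_convolution:
  fixes \<chi> :: "nat \<Rightarrow> real"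
  assumes mult: "\<And>a b. \<chi> (a * b) = \<chi> a * \<chi> b"
  shows "(\<Sum>n=1..x. \<chi> n * ln (real n) / real n) =
    (\<Sum>d=1..x. \<chi> d * mangoldt d / real d * (\<Sum>m=1..x div d. \<chi> m / real m))"
proof -
  have "(\<Sum>n=1..x. \<chi> n * ln (real n) / real n)
      = (\<Sum>n=1..x. \<Sum>d | d dvd n. (\<chi> d * mangoldt d / real d) * (\<chi> (n div d) / real (n div d)))"
  proof (intro sum.cong refl)
    fix n assume n: "n \<in> {1..x}"
    have "\<chi> n * ln (real n) / real n = (\<Sum>d | d dvd n. \<chi> n * mangoldt d / real n)"
      using mangoldt_sum[of n, where ?'a = real] n
      by (simp add: sum_divide_distrib[symmetric] sum_distrib_left[symmetric])
    also have "\<dots> = (\<Sum>d | d dvd n. (\<chi> d * mangoldt d / real d) * (\<chi> (n div d) / real (n div d)))"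
      by (intro sum.cong refl) (use n in \<open>auto simp: mult dvd_def\<close>)
    finally show "\<chi> n * ln (real n) / real n = \<dots>" .
  qed
  also have "\<dots> = (\<Sum>d=1..x. \<chi> d * mangoldt d / real d * (\<Sum>m=1..x div d. \<chi> m / real m))"
    by (subst sum_divisors_swap) (simp add: sum_distrib_left)
  finally show ?thesis .
qed

text \<open>In the convolution identity the inner sum is L up to an error O(d/x). Chebyshev's bound
  keeps the accumulated error bounded, and the logarithmic sum is bounded as well; so L times the
  sum in question is bounded.\<close>

lemma (in real_character) sum_mangoldt_bounded:
  assumes "L \<noteq> 0"
  shows "\<exists>B. \<forall>x. \<bar>\<Sum>d=1..x. \<chi> d * mangoldt d / real d\<bar> \<le> B"
proof -
  obtain B where B: "\<bar>\<Sum>n=1..x. \<chi> n * ln (real n) / real n\<bar> \<le> B" for x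
    using sum_ln_bounded by blast
  define C where "C = 2 * real K * (4 * ln 2)"
  have "\<bar>\<Sum>d=1..x. \<chi> d * mangoldt d / real d\<bar> \<le> (B + C) / \<bar>L\<bar>" for x
  proof -
    define R where "R = (\<lambda>d. (\<Sum>m=1..x div d. \<chi> m / real m) - L)"
    have "\<bar>\<Sum>d=1..x. \<chi> d * mangoldt d / real d * R d\<bar> \<le> (\<Sum>d=1..x. mangoldt d * (2 * real K / real x))"
    proof (intro order_trans[OF sum_abs] sum_mono)
      fix d assume d: "d \<in> {1..x}"
      have "\<bar>R d\<bar> \<le> 2 * real K / real (Suc (x div d))"
        unfolding R_def by (rule L_approx)
      also have "\<dots> \<le> 2 * real K * real d / real x"
      proof -
        have "x \<le> d * Suc (x div d)"
          using d by (metis atLeastAtMost_iff dividend_less_times_div less_imp_le_nat mult_Suc_right add.commute order_less_le_trans zero_less_one)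
        then have "real x \<le> real d * real (Suc (x div d))" by (metis of_nat_mono of_nat_mult)
        then have "2 * real K * real x \<le> 2 * real K * (real d * real (Suc (x div d)))"
          by (intro mult_left_mono) auto
        then show ?thesis using d by (simp add: divide_simps mult_ac)
      qed
      finally have R: "\<bar>R d\<bar> \<le> 2 * real K * real d / real x" .
      have "\<bar>\<chi> d * mangoldt d / real d * R d\<bar> = \<bar>\<chi> d\<bar> * (mangoldt d / real d * \<bar>R d\<bar>)"
        by (simp add: abs_mult)
      also have "\<dots> \<le> 1 * (mangoldt d / real d * (2 * real K * real d / real x))"
        using R abs_le_1[of d] by (intro mult_mono mult_nonneg_nonneg divide_nonneg_nonneg) (auto simp: mangoldt_nonneg)
      also have "\<dots> = mangoldt d * (2 * real K / real x)" using d by simp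
      finally show "\<bar>\<chi> d * mangoldt d / real d * R d\<bar> \<le> mangoldt d * (2 * real K / real x)" .
    qed
    also have "\<dots> = (\<Sum>d=1..x. mangoldt d) * (2 * real K / real x)"
      by (rule sum_distrib_right[symmetric])
    also have "\<dots> \<le> 4 * ln 2 * real x * (2 * real K / real x)"
      by (intro mult_right_mono sum_mangoldt_le) auto
    also have "\<dots> \<le> C" by (simp add: C_def)
    finally have 1: "\<bar>\<Sum>d=1..x. \<chi> d * mangoldt d / real d * R d\<bar> \<le> C" .
    have "(\<Sum>n=1..x. \<chi> n * ln (real n) / real n)
        = (\<Sum>d=1..x. \<chi> d * mangoldt d / real d * (R d + L))"
      by (subst sum_mangoldt_convolution[OF mult]) (simp add: R_def)
    also have "\<dots> = (\<Sum>d=1..x. \<chi> d * mangoldt d / real d * R d)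
        + (\<Sum>d=1..x. \<chi> d * mangoldt d / real d) * L"
      by (simp add: ring_distribs sum.distrib sum_distrib_right)
    finally have "\<bar>(\<Sum>d=1..x. \<chi> d * mangoldt d / real d) * L\<bar> \<le> B + C"
      using B[of x] 1 by linarith
    then show ?thesis using assms by (simp add: abs_mult field_simps)
  qed
  then show ?thesis by blast
qed

text \<open>The divisor sum is multiplicative in n. At a prime power it is the sum of the
  \<open>\<chi> p ^ i\<close>: alternating, hence 0 or 1, if \<open>\<chi> p = -1\<close>, and at
  least 1 otherwise. An even exponent gives at least 1 in either case.\<close>

lemma sum_divisors_nonneg:
  fixes \<chi> :: "nat \<Rightarrow> real"
  assumes mult: "\<And>a b. \<chi> (a * b) = \<chi> a * \<chi> b" and one: "\<chi> 1 = 1"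
    and range: "\<And>a. \<chi> a \<in> {-1, 0, 1}" and "0 < n"
  shows "0 \<le> (\<Sum>d | d dvd n. \<chi> d)" and "1 \<le> (\<Sum>d | d dvd n^2. \<chi> d)"
proof -
  have power: "\<chi> (a ^ k) = \<chi> a ^ k" for a k
    using one by (induction k) (auto simp: mult)
  have prime_power: "0 \<le> (\<Sum>i\<le>k. \<chi> (p ^ i)) \<and> (even k \<longrightarrow> 1 \<le> (\<Sum>i\<le>k. \<chi> (p ^ i)))" for p k
  proof (cases "\<chi> p = -1")
    case True
    have "(\<Sum>i\<le>k. \<chi> (p ^ i)) = (if even k then 1 else 0)"
      unfolding power True by (induction k) auto
    then show ?thesis by simp
  next
    case False
    then have "0 \<le> \<chi> p" using range[of p] by auto
    then have "0 \<le> (\<Sum>i=1..k. \<chi> p ^ i)" by (intro sum_nonneg) auto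
    moreover have "(\<Sum>i\<le>k. \<chi> p ^ i) = 1 + (\<Sum>i=1..k. \<chi> p ^ i)"
      by (simp add: atMost_atLeast0 sum.atLeast_Suc_atMost)
    ultimately show ?thesis unfolding power by simp
  qed
  \<comment> \<open>Both claims share one induction that splits off the full power of a prime: from
    a square this removes an even power and leaves a square.\<close>
  have "0 \<le> (\<Sum>d | d dvd n. \<chi> d) \<and> ((\<exists>m. n = m\<^sup>2) \<longrightarrow> 1 \<le> (\<Sum>d | d dvd n. \<chi> d))" if "0 < n" for n
    using that
  proof (induction n rule: less_induct)
    case (less n)
    show ?case
    proof (cases "n = 1")
      case True
      have "{d. d dvd n} = {1}" using True by auto
      then show ?thesis using one by simp
    next
      case False
      then obtain p where p: "prime p" "p dvd n" using prime_factor_nat by blast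
      define k where "k = multiplicity p n"
      obtain r where r: "n = p ^ k * r" "\<not> p dvd r"
        using multiplicity_decompose'[of n p] less.prems p unfolding k_def by (metis not_prime_unit not_gr_zero)
      have "0 < k" unfolding k_def using p less.prems by (simp add: prime_multiplicity_gt_zero_iff)
      have "1 < p ^ k" using p \<open>0 < k\<close> by (meson one_less_power prime_gt_1_nat)
      have "0 < r" using r(1) less.prems by (cases r) auto
      have "r < n" using r(1) \<open>1 < p ^ k\<close> \<open>0 < r\<close> by simp
      have copr: "coprime p d" if "d dvd r" for d
        using r(2) p that by (meson dvd_trans prime_imp_coprime)
      have bij: "bij_betw (\<lambda>(i, d). p ^ i * d) ({..k} \<times> {d. d dvd r}) {d. d dvd n}"
        proof (rule bij_betwI')
          fix x y assume "x \<in> {..k} \<times> {d. d dvd r}" "y \<in> {..k} \<times> {d. d dvd r}"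
          then obtain i d j e where xy: "x = (i, d)" "y = (j, e)" "d dvd r" "e dvd r" by auto
          have "i = j \<and> d = e" if eq: "p ^ i * d = p ^ j * e"
          proof -
            have "0 < d" "0 < e" using xy \<open>0 < r\<close> by (auto intro!: Nat.gr0I)
            have "\<not> p dvd d" "\<not> p dvd e" using xy r(2) dvd_trans by blast+
            then have "multiplicity p (p ^ i * d) = i" "multiplicity p (p ^ j * e) = j"
              using p \<open>0 < d\<close> \<open>0 < e\<close>
              by (auto simp: prime_elem_multiplicity_mult_distrib not_dvd_imp_multiplicity_0)
            with eq have "i = j" by simp
            then show ?thesis using eq p by (auto simp: prime_gt_0_nat)
          qed
          then show "((case x of (i, d) \<Rightarrow> p ^ i * d) = (case y of (i, d) \<Rightarrow> p ^ i * d)) = (x = y)"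
            using xy by auto
        next
          fix x assume "x \<in> {..k} \<times> {d. d dvd r}"
          then show "(case x of (i, d) \<Rightarrow> p ^ i * d) \<in> {d. d dvd n}"
            using r(1) by (auto intro!: mult_dvd_mono le_imp_power_dvd)
        next
          fix y assume "y \<in> {d. d dvd n}"
          then have "y dvd p ^ k * r" using r(1) by simp
          then obtain a b where ab: "y = a * b" "a dvd p ^ k" "b dvd r"
            using division_decomp by blast
          then obtain i where "i \<le> k" "a = p ^ i" using p divides_primepow_nat by blast
          with ab show "\<exists>x\<in>{..k} \<times> {d. d dvd r}. y = (case x of (i, d) \<Rightarrow> p ^ i * d)" by auto
        qed
      have "(\<Sum>d | d dvd n. \<chi> d) = (\<Sum>(i, d)\<in>{..k} \<times> {d. d dvd r}. \<chi> (p ^ i) * \<chi> d)"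
        by (subst sum.reindex_bij_betw[OF bij, symmetric]) (intro sum.cong, auto simp: mult)
      also have "\<dots> = (\<Sum>i\<le>k. \<chi> (p ^ i)) * (\<Sum>d | d dvd r. \<chi> d)"
        by (simp add: sum_product sum.cartesian_product)
      finally have eq: "(\<Sum>d | d dvd n. \<chi> d) = \<dots>" .
      note IH = less.IH[OF \<open>r < n\<close> \<open>0 < r\<close>]
      have "1 \<le> (\<Sum>d | d dvd n. \<chi> d)" if sq: "n = m\<^sup>2" for m
      proof -
        have "0 < m" using sq less.prems by (auto intro: Nat.gr0I)
        then obtain s where s: "m = p ^ multiplicity p m * s" "\<not> p dvd s"
          using multiplicity_decompose'[of m p] p by (metis not_prime_unit not_gr_zero)
        have k: "k = 2 * multiplicity p m"
          unfolding k_def sq using p \<open>0 < m\<close> by (simp add: prime_elem_multiplicity_power_distrib)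
        have "p ^ k * r = p ^ k * s\<^sup>2"
          using r(1) sq k by (subst (asm) s(1)) (auto simp: power_mult_distrib mult.commute simp flip: power_mult)
        then have "r = s\<^sup>2" using p by (auto simp: prime_gt_0_nat)
        moreover have "even k" using k by simp
        ultimately have "1 \<le> (\<Sum>i\<le>k. \<chi> (p ^ i))" "1 \<le> (\<Sum>d | d dvd r. \<chi> d)"
          using IH prime_power[of p k] by auto
        then have "1 * 1 \<le> (\<Sum>i\<le>k. \<chi> (p ^ i)) * (\<Sum>d | d dvd r. \<chi> d)"
          by (intro mult_mono) auto
        then show ?thesis unfolding eq by simp
      qed
      moreover have "0 \<le> (\<Sum>d | d dvd n. \<chi> d)"
        unfolding eq using IH prime_power[of p k] by simp
      ultimately show ?thesis by blast
    qed
  qed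
  from this[of n] this[of "n^2"] \<open>0 < n\<close> 
  show "0 \<le> (\<Sum>d | d dvd n. \<chi> d)" and "1 \<le> (\<Sum>d | d dvd n^2. \<chi> d)"
    by auto
qed

text \<open>D decreases, its companion E with \<open>sqrt (real (Suc y))\<close> increases, and E
  lies below D by at most \<open>1 / sqrt (real y)\<close>. This is convergence to a constant,
  expressed between two finite levels so that no limit has to be named.\<close>

lemma sum_inverse_sqrt_gap:
  assumes "1 \<le> y" "y \<le> z"
  defines "D \<equiv> \<lambda>y. (\<Sum>e=1..y. 1 / sqrt (real e)) - 2 * sqrt (real y)"
  shows "D z \<le> D y" and "D y \<le> D z + 1 / sqrt (real y)"
proof -
  have sqrt_diff: "sqrt (real (Suc n)) - sqrt (real n) = 1 / (sqrt (real (Suc n)) + sqrt (real n))" for n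
  proof -
    have "(sqrt (real (Suc n)) - sqrt (real n)) * (sqrt (real (Suc n)) + sqrt (real n)) = 1"
      by (simp add: algebra_simps flip: power2_eq_square)
    moreover have "0 < sqrt (real (Suc n)) + sqrt (real n)" by (simp add: add_pos_nonneg)
    ultimately show ?thesis by (metis nonzero_eq_divide_eq less_irrefl)
  qed
  have "D (Suc n) \<le> D n" for n
  proof -
    have "1 / (2 * sqrt (real (Suc n))) \<le> 1 / (sqrt (real (Suc n)) + sqrt (real n))"
      by (intro divide_left_mono mult_pos_pos add_pos_nonneg) auto
    then show ?thesis using sqrt_diff[of n] by (simp add: D_def)
  qed
  then show "D z \<le> D y" using \<open>y \<le> z\<close> by (rule lift_Suc_antimono_le[of D])
  define E where "E = (\<lambda>y. (\<Sum>e=1..y. 1 / sqrt (real e)) - 2 * sqrt (real (Suc y)))"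
  have "E n \<le> E (Suc n)" for n
  proof -
    have "1 / (sqrt (real (Suc (Suc n))) + sqrt (real (Suc n))) \<le> 1 / (2 * sqrt (real (Suc n)))"
      by (intro divide_left_mono mult_pos_pos add_pos_nonneg) auto
    then show ?thesis using sqrt_diff[of "Suc n"] by (simp add: E_def)
  qed
  then have "E y \<le> E z" using \<open>y \<le> z\<close> by (rule lift_Suc_mono_le)
  moreover have "D y \<le> E y + 1 / sqrt (real y)"
  proof -
    have "1 / (sqrt (real (Suc y)) + sqrt (real y)) \<le> 1 / (2 * sqrt (real y))"
      using assms(1) by (intro divide_left_mono mult_pos_pos add_pos_pos) auto
    then show ?thesis using sqrt_diff[of y] by (simp add: D_def E_def)
  qed
  moreover have "E z \<le> D z" by (simp add: D_def E_def)
  ultimately show "D y \<le> D z + 1 / sqrt (real y)" by linarith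
qed

lemma sum_inverse_sqrt_le: "(\<Sum>e=1..M. 1 / sqrt (real e)) \<le> 2 * sqrt (real M)"
  using sum_inverse_sqrt_gap(1)[of 1 M] by (cases "M = 0") auto

text \<open>Here c depends on M but not on d, so it can later be pulled out of a character sum over
  d. Two errors occur, the gap of the preceding lemma and the passage from sqrt(y) to Y; they have
  opposite signs and each is at most 1/sqrt(y). The factor 3 comes from the crude bound
  \<open>Y\<^sup>2 \<le> 9 * real y\<close>.\<close>

lemma sum_inverse_sqrt_approx:
  assumes d: "1 \<le> d" "d \<le> M"
  defines "c \<equiv> (\<Sum>e=1..M\<^sup>2. 1 / sqrt (real e)) - 2 * real M"
  shows "\<bar>(\<Sum>e=1..M\<^sup>2 div d. 1 / sqrt (real e)) - 2 * real M / sqrt (real d) - c\<bar> \<le> 3 * sqrt (real d) / real M"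
proof -
  define y where "y = M\<^sup>2 div d"
  define Y where "Y = real M / sqrt (real d)"
  have M: "1 \<le> M" using d by simp
  have "d \<le> M\<^sup>2" using d by (simp add: power2_eq_square) (metis M le_trans mult_le_mono1 nat_mult_1)
  then have y1: "1 \<le> y" unfolding y_def using d by (simp add: less_eq_div_iff_mult_less_eq)
  have yM: "y \<le> M\<^sup>2" by (simp add: y_def)
  have Y2: "Y\<^sup>2 = real (M\<^sup>2) / real d" using d by (simp add: Y_def power_divide)
  have Ypos: "0 < Y" using d M by (simp add: Y_def)
  have "real (y * d) \<le> real (M\<^sup>2)" unfolding y_def by (intro of_nat_mono) simp
  then have ylow: "real y \<le> Y\<^sup>2" unfolding Y2 using d by (simp add: field_simps)
  have "M\<^sup>2 \<le> d * Suc y"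
    unfolding y_def using d dividend_less_times_div[of d "M\<^sup>2"] by simp
  then have "real (M\<^sup>2) \<le> real (d * Suc y)" by (rule of_nat_mono)
  then have yup: "Y\<^sup>2 \<le> real y + 1" unfolding Y2 using d by (simp add: field_simps)
  have "sqrt (real y) \<le> Y" using ylow Ypos by (simp add: real_le_lsqrt)
  moreover have "Y \<le> sqrt (real y) + 1 / (2 * sqrt (real y))"
  proof (rule power2_le_imp_le)
    have "(sqrt (real y) + 1 / (2 * sqrt (real y)))\<^sup>2 = real y + 1 + (1 / (2 * sqrt (real y)))\<^sup>2"
      using y1 by (simp add: power2_sum)
    with yup zero_le_power2[of "1 / (2 * sqrt (real y))"]
    show "Y\<^sup>2 \<le> (sqrt (real y) + 1 / (2 * sqrt (real y)))\<^sup>2" by linarith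
  qed simp
  moreover have "(\<Sum>e=1..y. 1 / sqrt (real e)) - 2 * sqrt (real y) - c \<in> {0..1 / sqrt (real y)}"
    using sum_inverse_sqrt_gap[OF y1 yM] by (simp add: c_def)
  moreover have "1 / sqrt (real y) \<le> 3 * sqrt (real d) / real M"
  proof -
    have "Y\<^sup>2 \<le> 9 * real y" using yup y1 by linarith
    then have "Y \<le> 3 * sqrt (real y)"
      by (intro power2_le_imp_le[of Y]) (simp_all add: power_mult_distrib)
    then have "real M \<le> 3 * sqrt (real y) * sqrt (real d)"
      using d by (simp add: Y_def divide_simps split: if_splits)
    then show ?thesis using M y1 by (simp add: divide_simps mult_ac)
  qed
  ultimately show ?thesis
    unfolding y_def[symmetric] by (simp add: Y_def abs_le_iff)
qed

context real_character
begin

text \<open>Dirichlet's hyperbola method: if $L(1,\chi) = 0$, then $\sum_{n\le M^2} (1*\chi)(n)/\sqrt n$ is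
  bounded, although its terms are nonnegative and the squares alone contribute a harmonic sum.\<close>

lemma L_nonzero: "L \<noteq> 0"
proof
  assume L0: "L = 0"
  define h where "h = (\<lambda>d e. \<chi> d / sqrt (real d) * (1 / sqrt (real e)))"
  \<comment> \<open>The part with d > M contributes at most 8K, the part with d \<le> M at most 12K
    + 3.\<close>
  define B where "B = 8 * real K + 3 + 4 * real K + 8 * real K"
  have anti: "1 / sqrt (real (Suc n)) \<le> 1 / sqrt (real n)" if "1 \<le> n" for n
    using that by (intro divide_left_mono) auto
  have "(\<Sum>k=1..M. 1 / real k) \<le> B" if M: "1 \<le> M" for M
  proof -
    let ?x = "M\<^sup>2"
    have inj: "inj_on (\<lambda>k::nat. k\<^sup>2) {1..M}" by (auto simp: inj_on_def)
    have "(\<Sum>k=1..M. 1 / real k) \<le> (\<Sum>k=1..M. (\<Sum>d | d dvd k\<^sup>2. \<chi> d) / sqrt (real (k\<^sup>2)))"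
      by (intro sum_mono) (use sum_divisors_nonneg(2)[of \<chi>, OF mult one range] in
        \<open>auto intro!: divide_right_mono\<close>)
    also have "\<dots> = (\<Sum>n\<in>(\<lambda>k. k\<^sup>2) ` {1..M}. (\<Sum>d | d dvd n. \<chi> d) / sqrt (real n))"
      using sum.reindex[OF inj, of "\<lambda>n. (\<Sum>d | d dvd n. \<chi> d) / sqrt (real n)"] by (simp add: o_def)
    also have "\<dots> \<le> (\<Sum>n=1..?x. (\<Sum>d | d dvd n. \<chi> d) / sqrt (real n))"
    proof (intro sum_mono2)
      show "(\<lambda>k. k\<^sup>2) ` {1..M} \<subseteq> {1..?x}" by (auto intro: power_mono)
    qed (use sum_divisors_nonneg(1)[of \<chi>, OF mult one range] in \<open>auto intro!: divide_nonneg_nonneg\<close>)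
    also have "\<dots> = (\<Sum>n=1..?x. \<Sum>d | d dvd n. h d (n div d))"
    proof (intro sum.cong refl)
      fix n assume n: "n \<in> {1..?x}"
      show "(\<Sum>d | d dvd n. \<chi> d) / sqrt (real n) = (\<Sum>d | d dvd n. h d (n div d))"
        unfolding sum_divide_distrib
        by (intro sum.cong refl) (use n in \<open>auto simp: h_def dvd_def real_sqrt_mult\<close>)
    qed
    also have "\<dots> = (\<Sum>d=1..?x. \<Sum>e=1..?x div d. h d e)" by (rule sum_divisors_swap)
    \<comment> \<open>For d \<le> M the sum over e is nearly 2M/sqrt(d) + c. For d > M the cofactor
      e is at most M, and the sum over d is taken first to exploit the cancellation of
      \<chi>.\<close>
    also have "\<dots> = (\<Sum>d=1..M. \<Sum>e=1..?x div d. h d e) + (\<Sum>d=Suc M..?x. \<Sum>e=1..?x div d. h d e)"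
      using M sum.ub_add_nat[of 1 M "\<lambda>d. \<Sum>e=1..?x div d. h d e" "?x - M"] by (simp add: power2_eq_square)
    also have "(\<Sum>d=Suc M..?x. \<Sum>e=1..?x div d. h d e) = (\<Sum>e=1..M. \<Sum>d=Suc M..?x div e. h d e)"
    proof -
      have "(\<Sum>d=Suc M..?x. \<Sum>e=1..?x div d. h d e)
          = (\<Sum>(d, e)\<in>(SIGMA d:{Suc M..?x}. {1..?x div d}). h d e)"
        by (rule sum.Sigma) auto
      also have "\<dots> = (\<Sum>(e, d)\<in>(SIGMA e:{1..M}. {Suc M..?x div e}). h d e)"
      proof (rule sum.reindex_bij_witness[of _ "\<lambda>(e, d). (d, e)" "\<lambda>(d, e). (e, d)"], goal_cases)
        case (2 a)
        then obtain d e where a: "a = (d, e)" "Suc M \<le> d" "d \<le> ?x" "1 \<le> e" "e \<le> ?x div d" by auto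
        have de: "d * e \<le> ?x" using a by (simp add: less_eq_div_iff_mult_less_eq mult.commute)
        have "e \<le> M"
        proof (rule ccontr)
          assume "\<not> e \<le> M"
          then have "Suc M * Suc M \<le> d * e" using a by (intro mult_mono) auto
          then show False using de by (simp add: power2_eq_square)
        qed
        then show ?case using a de by (auto simp: less_eq_div_iff_mult_less_eq)
      next
        case (4 a)
        then obtain d e where a: "a = (e, d)" "Suc M \<le> d" "1 \<le> e" "e \<le> M" "d \<le> ?x div e" by auto
        have de: "d * e \<le> ?x" using a by (simp add: less_eq_div_iff_mult_less_eq mult.commute)
        have "d \<le> ?x" using a(5) div_le_dividend order_trans by blast
        then show ?case using a de by (auto simp: less_eq_div_iff_mult_less_eq mult.commute)
      qed auto
      also have "\<dots> = (\<Sum>e=1..M. \<Sum>d=Suc M..?x div e. h d e)"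
        by (rule sum.Sigma[symmetric]) auto
      finally show ?thesis .
    qed
    also have "\<dots> \<le> 4 * real K * 2"
    proof -
      have "(\<Sum>e=1..M. \<Sum>d=Suc M..?x div e. h d e) \<le> (\<Sum>e=1..M. 1 / sqrt (real e) * (2 * real K * (1 / sqrt (real M))))"
      proof (intro sum_mono)
        fix e assume "e \<in> {1..M}"
        have "(\<Sum>d=Suc M..?x div e. h d e) = (\<Sum>d=Suc M..?x div e. \<chi> d * (1 / sqrt (real d))) * (1 / sqrt (real e))"
          unfolding h_def sum_distrib_right by simp
        also have "\<dots> \<le> (2 * real K * (1 / sqrt (real (Suc M)))) * (1 / sqrt (real e))"
          using abs_weighted_sum_atLeastAtMost[of "Suc M" "\<lambda>d. 1 / sqrt (real d)" "?x div e"] anti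
          by (intro mult_right_mono) (auto dest: abs_le_D1)
        also have "\<dots> \<le> (2 * real K * (1 / sqrt (real M))) * (1 / sqrt (real e))"
          using M anti by (intro mult_right_mono mult_left_mono) auto
        finally show "(\<Sum>d=Suc M..?x div e. h d e) \<le> 1 / sqrt (real e) * (2 * real K * (1 / sqrt (real M)))"
          by (simp add: mult_ac)
      qed
      also have "\<dots> = (\<Sum>e=1..M. 1 / sqrt (real e)) * (2 * real K * (1 / sqrt (real M)))"
        by (rule sum_distrib_right[symmetric])
      also have "\<dots> \<le> 2 * sqrt (real M) * (2 * real K * (1 / sqrt (real M)))"
        by (intro mult_right_mono sum_inverse_sqrt_le) auto
      finally show ?thesis using M by simp
    qed
    also have "(\<Sum>d=1..M. \<Sum>e=1..?x div d. h d e) \<le> 4 * real K + 3 + 8 * real K"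
    proof -
      define c where "c = (\<Sum>e=1..?x. 1 / sqrt (real e)) - 2 * real M"
      define r where "r = (\<lambda>d. (\<Sum>e=1..?x div d. 1 / sqrt (real e)) - 2 * real M / sqrt (real d) - c)"
      have c: "\<bar>c\<bar> \<le> 2"
      proof -
        have "c \<le> 0" using sum_inverse_sqrt_le[of "?x"] by (simp add: c_def)
        moreover have "- 1 \<le> c + 1"
          using sum_inverse_sqrt_gap(2)[of 1 "?x"] M by (simp add: c_def)
        ultimately show ?thesis by simp
      qed
      have "(\<Sum>d=1..M. \<Sum>e=1..?x div d. h d e)
          = (\<Sum>d=1..M. \<chi> d / sqrt (real d) * (2 * real M / sqrt (real d) + c + r d))"
        by (simp add: h_def r_def sum_distrib_left)
      also have "\<dots> = (\<Sum>d=1..M. 2 * real M * (\<chi> d / real d) + c * (\<chi> d * (1 / sqrt (real d))) + \<chi> d / sqrt (real d) * r d)"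
      proof (intro sum.cong refl)
        fix d assume "d \<in> {1..M}"
        have "real d = sqrt (real d) * sqrt (real d)" by simp
        then show "\<chi> d / sqrt (real d) * (2 * real M / sqrt (real d) + c + r d)
          = 2 * real M * (\<chi> d / real d) + c * (\<chi> d * (1 / sqrt (real d))) + \<chi> d / sqrt (real d) * r d"
          by (simp add: ring_distribs mult_ac del: real_sqrt_mult_self)
      qed
      also have "\<dots> = 2 * real M * (\<Sum>d=1..M. \<chi> d / real d) + c * (\<Sum>d=1..M. \<chi> d * (1 / sqrt (real d)))
          + (\<Sum>d=1..M. \<chi> d / sqrt (real d) * r d)"
        by (simp only: sum.distrib sum_distrib_left)
      also have "\<dots> \<le> 2 * real M * (2 * real K / real (Suc M)) + 2 * (2 * real K) + 3"
      proof (intro add_mono)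
        \<comment> \<open>This is where L = 0 enters: the partial sum of \<chi>(d)/d is then O(1/M),
          which compensates the factor 2M.\<close>
        show "2 * real M * (\<Sum>d=1..M. \<chi> d / real d) \<le> 2 * real M * (2 * real K / real (Suc M))"
          using L_approx[of M] L0 by (intro mult_left_mono) (auto dest: abs_le_D1)
        have "\<bar>\<Sum>d=1..M. \<chi> d * (1 / sqrt (real d))\<bar> \<le> 2 * real K * (1 / sqrt (real 1))"
          using anti by (intro abs_weighted_sum_atLeastAtMost) auto
        then have "\<bar>c\<bar> * \<bar>\<Sum>d=1..M. \<chi> d * (1 / sqrt (real d))\<bar> \<le> 2 * (2 * real K)"
          using c by (intro mult_mono) auto
        then show "c * (\<Sum>d=1..M. \<chi> d * (1 / sqrt (real d))) \<le> 2 * (2 * real K)"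
          by (metis abs_mult abs_le_D1)
        have "(\<Sum>d=1..M. \<chi> d / sqrt (real d) * r d) \<le> (\<Sum>d=1..M. 3 / real M)"
        proof (intro sum_mono)
          fix d assume d: "d \<in> {1..M}"
          have "\<chi> d / sqrt (real d) * r d \<le> \<bar>\<chi> d\<bar> * (1 / sqrt (real d) * \<bar>r d\<bar>)"
            using abs_ge_self[of "\<chi> d / sqrt (real d) * r d"] by (simp add: abs_mult)
          also have "\<dots> \<le> 1 * (1 / sqrt (real d) * (3 * sqrt (real d) / real M))"
            using d abs_le_1[of d] sum_inverse_sqrt_approx[of d M]
            by (intro mult_mono) (auto simp: r_def c_def)
          also have "\<dots> = 3 / real M" using d by simp
          finally show "\<chi> d / sqrt (real d) * r d \<le> 3 / real M" .
        qed
        then show "(\<Sum>d=1..M. \<chi> d / sqrt (real d) * r d) \<le> 3" using M by simp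
      qed
      also have "2 * real M * (2 * real K / real (Suc M)) \<le> 4 * real K"
      proof -
        have "real M / real (Suc M) \<le> 1" by simp
        from mult_right_mono[OF this, of "4 * real K"] show ?thesis by (simp add: mult_ac)
      qed
      finally show ?thesis by simp
    qed
    finally show ?thesis by (simp add: B_def)
  qed
  moreover obtain M where "B < (\<Sum>k=1..M. 1 / real k)" using harmonic_unbounded by blast
  moreover have "1 \<le> M" using calculation(2) by (cases M) (auto simp: B_def)
  ultimately show False by force
qed

end

section \<open>Primes with prescribed quadratic characters\<close>

text \<open>If these sums were at most B, the convolution identity would bound the sum of \<chi>(n)
  ln(n)/n by B times \<open>H x\<close>, the sum of \<chi>(n)/n. Since ln(n) outgrows B + 1, this
  keeps H bounded; but H contains the terms with n = jK + 1, comparable to a harmonic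
  series.\<close>

lemma sum_coprime_mangoldt_unbounded:
  fixes K :: nat and \<chi> :: "nat \<Rightarrow> real"
  assumes "0 < K"
  defines "\<chi> \<equiv> \<lambda>n. if coprime n K then 1 else 0"
  shows "\<exists>x. B < (\<Sum>d=1..x. \<chi> d * mangoldt d / real d)"
proof (rule ccontr)
  assume "\<not> ?thesis"
  then have B: "(\<Sum>d=1..x. \<chi> d * mangoldt d / real d) \<le> B" for x by (simp add: not_less)
  define H where "H = (\<lambda>x. \<Sum>m=1..x. \<chi> m / real m)"
  \<comment> \<open>Subtracting B + 1 instead of B leaves a whole \<open>H x\<close> over, while the
    summands are still nonnegative for large n.\<close>
  define g where "g = (\<lambda>n. \<chi> n * (ln (real n) - B - 1) / real n)"
  have pos: "0 \<le> \<chi> n" for n by (simp add: \<chi>_def)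
  have mult: "\<chi> (a * b) = \<chi> a * \<chi> b" for a b by (simp add: \<chi>_def)
  have "(\<Sum>n=1..x. \<chi> n * ln (real n) / real n) \<le> B * H x" for x
  proof -
    have "(\<Sum>n=1..x. \<chi> n * ln (real n) / real n)
        = (\<Sum>d=1..x. \<chi> d * mangoldt d / real d * (\<Sum>m=1..x div d. \<chi> m / real m))"
      by (rule sum_mangoldt_convolution[OF mult])
    also have "\<dots> \<le> (\<Sum>d=1..x. \<chi> d * mangoldt d / real d * H x)"
      unfolding H_def
      by (intro sum_mono mult_left_mono sum_mono2) (auto simp: pos mangoldt_nonneg intro: order_trans[OF _ div_le_dividend])
    also have "\<dots> = (\<Sum>d=1..x. \<chi> d * mangoldt d / real d) * H x"
      by (rule sum_distrib_right[symmetric])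
    also have "\<dots> \<le> B * H x"
      unfolding H_def by (intro mult_right_mono B sum_nonneg) (auto simp: pos)
    finally show ?thesis .
  qed
  moreover have "(\<Sum>n=1..x. g n) = (\<Sum>n=1..x. \<chi> n * ln (real n) / real n) - B * H x - H x" for x
    by (simp add: g_def H_def right_diff_distrib diff_divide_distrib sum_subtractf sum_distrib_left mult_ac)
  ultimately have upper: "H x \<le> - (\<Sum>n=1..x. g n)" for x by (smt (verit))
  obtain N where "exp (B + 1) < real N" using reals_Archimedean2 by blast
  have g_nonneg: "0 \<le> g n" if "N \<le> n" for n
  proof -
    have "exp (B + 1) \<le> real n" using \<open>exp (B + 1) < real N\<close> that by linarith
    then have "B + 1 \<le> ln (real n)" using exp_gt_zero[of "B + 1"] by (subst ln_ge_iff) linarith+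
    then show ?thesis by (simp add: g_def pos)
  qed
  define C where "C = (\<Sum>n=1..N. \<bar>g n\<bar>)"
  have H_le: "H x \<le> C" for x
  proof -
    have "- (\<Sum>n=1..x. g n) = (\<Sum>n=1..x. - g n)" by (simp add: sum_negf)
    also have "\<dots> \<le> (\<Sum>n=1..x. if n \<le> N then \<bar>g n\<bar> else 0)"
      using g_nonneg by (intro sum_mono) (auto simp: abs_if)
    also have "\<dots> = (\<Sum>n\<in>{1..x} \<inter> {..N}. \<bar>g n\<bar>)"
      by (intro sum.mono_neutral_cong_right) auto
    also have "\<dots> \<le> C"
      unfolding C_def by (intro sum_mono2) auto
    finally show ?thesis using upper[of x] by linarith
  qed
  obtain J where J: "C * real (K + 1) < (\<Sum>j=1..J. 1 / real j)" using harmonic_unbounded by blast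
  have "(\<Sum>j=1..J. 1 / real j) / real (K + 1) = (\<Sum>j=1..J. 1 / (real (K + 1) * real j))"
    by (simp add: sum_divide_distrib mult.commute)
  also have "\<dots> \<le> (\<Sum>j=1..J. \<chi> (j * K + 1) / real (j * K + 1))"
  proof (intro sum_mono)
    fix j assume j: "j \<in> {1..J}"
    have "gcd (j * K + 1) K = 1" by (metis gcd.commute gcd_add_mult gcd_1_nat add.commute mult.commute)
    then have "\<chi> (j * K + 1) = 1" unfolding \<chi>_def by (simp only: coprime_iff_gcd_eq_1 refl if_True)
    moreover have "1 / (real (K + 1) * real j) \<le> 1 / real (j * K + 1)"
      using j by (intro divide_left_mono) (auto simp: algebra_simps intro!: mult_pos_pos add_pos_nonneg)
    ultimately show "1 / (real (K + 1) * real j) \<le> \<chi> (j * K + 1) / real (j * K + 1)" by simp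
  qed
  also have "\<dots> = (\<Sum>n\<in>(\<lambda>j. j * K + 1) ` {1..J}. \<chi> n / real n)"
    using sum.reindex[of "\<lambda>j. j * K + 1" "{1..J}" "\<lambda>n. \<chi> n / real n"] assms(1)
    by (simp add: o_def inj_on_def)
  also have "\<dots> \<le> H (J * K + 1)"
    unfolding H_def by (intro sum_mono2) (auto simp: pos)
  also have "\<dots> \<le> C" by (rule H_le)
  finally show False using J by (simp add: divide_simps)
qed

text \<open>Expand \<chi>0 times the product of the \<open>1 + \<epsilon> i * \<chi> i d\<close>
  over the subsets of I. The empty subset contributes the unbounded principal sum. Any other subset
  S contributes a bounded sum: for i in S, the witness of i has \<open>\<psi> S a = -1\<close>, so
  \<open>\<psi> S\<close> is nonprincipal. If no prime had the prescribed values, the total would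
  vanish.\<close>

theorem prime_with_prescribed_characters:
  fixes \<chi> :: "'i \<Rightarrow> nat \<Rightarrow> real" and \<epsilon> :: "'i \<Rightarrow> real"
  assumes I: "finite I" and K: "0 < K"
    and mult: "\<And>i a b. i \<in> I \<Longrightarrow> \<chi> i (a * b) = \<chi> i a * \<chi> i b"
    and periodic: "\<And>i a. i \<in> I \<Longrightarrow> \<chi> i (a + K) = \<chi> i a"
    and range: "\<And>i a. i \<in> I \<Longrightarrow> \<chi> i a \<in> {-1, 0, 1}"
    and one: "\<And>i. i \<in> I \<Longrightarrow> \<chi> i 1 = 1"
    and nonzero: "\<And>i a. i \<in> I \<Longrightarrow> coprime a K \<Longrightarrow> \<chi> i a \<noteq> 0"
    and witness: "\<And>i. i \<in> I \<Longrightarrow> \<exists>a. coprime a K \<and> \<chi> i a = -1 \<and> (\<forall>j\<in>I - {i}. \<chi> j a = 1)"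
    and sign: "\<And>i. i \<in> I \<Longrightarrow> \<epsilon> i \<in> {-1, 1}" and "k \<in> I" "\<epsilon> k = -1"
  shows "\<exists>q. prime q \<and> coprime q K \<and> (\<forall>i\<in>I. \<chi> i q = \<epsilon> i)"
proof (rule ccontr)
  assume neg: "\<not> ?thesis"
  define \<chi>0 :: "nat \<Rightarrow> real" where "\<chi>0 = (\<lambda>n. if coprime n K then 1 else 0)"
  define \<psi> where "\<psi> = (\<lambda>S n. \<chi>0 n * (\<Prod>i\<in>S. \<chi> i n))"
  have char: "real_character (\<psi> S) K" if S: "S \<subseteq> I" "S \<noteq> {}" for S
  proof
    have fin: "finite S" using S I finite_subset by blast
    show mult_S: "\<psi> S (a * b) = \<psi> S a * \<psi> S b" for a b
      using S(1) mult by (auto simp: \<psi>_def \<chi>0_def prod.distrib subset_iff)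
    show per_S: "\<psi> S (a + K) = \<psi> S a" for a
    proof -
      have "coprime (a + K) K \<longleftrightarrow> coprime a K" by (simp only: coprime_iff_gcd_eq_1 gcd_add1)
      then show ?thesis using S(1) periodic by (simp add: \<psi>_def \<chi>0_def subset_iff)
    qed
    show "\<psi> S a \<in> {-1, 0, 1}" for a
    proof -
      have "(\<Prod>i\<in>S. \<chi> i a) \<in> {-1, 0, 1}"
        using fin S(1)
      proof (induction S rule: finite_induct)
        case (insert i S)
        then show ?case using range[of i a] by auto
      qed auto
      then show ?thesis by (auto simp: \<psi>_def \<chi>0_def)
    qed
    show "\<psi> S 1 = 1" using one S(1) by (simp add: \<psi>_def \<chi>0_def subset_iff)
    obtain i where i: "i \<in> S" using S(2) by blast
    then obtain a where a: "coprime a K" "\<chi> i a = -1" "\<And>j. j \<in> I - {i} \<Longrightarrow> \<chi> j a = 1"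
      using witness S(1) by blast
    have psi_a: "\<psi> S a = -1"
    proof -
      have "(\<Prod>j\<in>S. \<chi> j a) = \<chi> i a * (\<Prod>j\<in>S - {i}. \<chi> j a)" using fin i by (rule prod.remove)
      also have "(\<Prod>j\<in>S - {i}. \<chi> j a) = 1" using a(3) S(1) by (intro prod.neutral) auto
      finally show ?thesis using a by (simp add: \<psi>_def \<chi>0_def)
    qed
    have psi_mod: "\<psi> S (n mod K) = \<psi> S n" for n
    proof (induction n rule: less_induct)
      case (less n)
      then show ?case
        using less[of "n - K"] per_S[of "n - K"] K by (cases "n < K") (auto simp: le_mod_geq not_less)
    qed
    \<comment> \<open>Multiplication by \<open>a\<close> permutes the residues modulo K and flips
      the sign of \<open>\<psi> S\<close>, so the sum over a period is its own negative.\<close>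
    have inj: "inj_on (\<lambda>n. a * n mod K) {..<K}"
    proof (rule inj_onI)
      fix m n assume mn: "m \<in> {..<K}" "n \<in> {..<K}" "a * m mod K = a * n mod K"
      then have "[a * m = a * n] (mod K)" by (simp add: cong_def)
      then have "[m = n] (mod K)" using a(1) by (simp add: cong_mult_lcancel_nat)
      then show "m = n" using mn by (simp add: cong_def)
    qed
    have img: "(\<lambda>n. a * n mod K) ` {..<K} = {..<K}"
      by (rule card_subset_eq) (use K inj in \<open>auto simp: card_image\<close>)
    have "(\<Sum>n<K. \<psi> S n) = (\<Sum>n<K. \<psi> S (a * n mod K))"
      using sum.reindex[OF inj, of "\<psi> S"] by (simp add: img)
    also have "\<dots> = - (\<Sum>n<K. \<psi> S n)"
      by (simp only: psi_mod mult_S psi_a sum_distrib_left[symmetric])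
    finally show "(\<Sum>n<K. \<psi> S n) = 0" by simp
  qed (rule K)
  have "\<exists>B. \<forall>x. \<bar>\<Sum>d=1..x. \<psi> S d * mangoldt d / real d\<bar> \<le> B" if "S \<in> Pow I - {{}}" for S
  proof -
    interpret real_character "\<psi> S" K using char that by auto
    show ?thesis by (rule sum_mangoldt_bounded[OF L_nonzero])
  qed
  then obtain B where B: "\<And>S x. S \<in> Pow I - {{}} \<Longrightarrow> \<bar>\<Sum>d=1..x. \<psi> S d * mangoldt d / real d\<bar> \<le> B S"
    by metis
  define F where "F = (\<lambda>d. \<chi>0 d * (\<Prod>i\<in>I. 1 + \<epsilon> i * \<chi> i d))"
  have F_expand: "F d = (\<Sum>S\<in>Pow I. (\<Prod>i\<in>S. \<epsilon> i) * \<psi> S d)" for d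
  proof -
    have "(\<Prod>i\<in>I. \<epsilon> i * \<chi> i d + 1) = (\<Sum>S\<in>Pow I. (\<Prod>i\<in>S. \<epsilon> i * \<chi> i d))"
      using prod_add[OF I, of "\<lambda>i. \<epsilon> i * \<chi> i d" "\<lambda>_. 1"] by simp
    then show ?thesis by (simp add: F_def \<psi>_def prod.distrib sum_distrib_left add.commute mult_ac)
  qed
  \<comment> \<open>Since \<open>\<epsilon> k = -1\<close>, only odd powers of a prime can have the prescribed character values, and these are the values at the prime itself.\<close>
  have F_zero: "F d * mangoldt d = 0" for d
  proof (cases "primepow d")
    case True
    then obtain p m where p: "prime p" "d = p ^ m" "0 < m" by (auto simp: primepow_def)
    show ?thesis
    proof (rule ccontr)
      assume "F d * mangoldt d \<noteq> 0"
      then have F: "F d \<noteq> 0" by auto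
      then have "coprime d K" by (auto simp: F_def \<chi>0_def split: if_splits)
      then have cop: "coprime p K" using p by simp
      have eq: "\<chi> i d = \<epsilon> i" if i: "i \<in> I" for i
      proof -
        have "1 + \<epsilon> i * \<chi> i d \<noteq> 0" using F I i by (auto simp: F_def)
        then show ?thesis using range[OF i, of d] nonzero[OF i \<open>coprime d K\<close>] sign[OF i] by auto
      qed
      have pow: "\<chi> i d = \<chi> i p ^ m" if i: "i \<in> I" for i
        unfolding p(2) using one[OF i] by (induction m) (auto simp: mult[OF i])
      have "odd m"
        using eq[OF \<open>k \<in> I\<close>] pow[OF \<open>k \<in> I\<close>] \<open>\<epsilon> k = -1\<close> zero_le_even_power[of m "\<chi> k p"] by auto
      then have "\<chi> i p = \<epsilon> i" if i: "i \<in> I" for i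
        using eq[OF i] pow[OF i] range[OF i, of p] p(3) by (auto simp: zero_power)
      then show False using neg p(1) cop by blast
    qed
  qed (simp add: mangoldt_def)
  obtain x where x: "(\<Sum>S\<in>Pow I - {{}}. B S) < (\<Sum>d=1..x. \<chi>0 d * mangoldt d / real d)"
    using sum_coprime_mangoldt_unbounded[OF K] unfolding \<chi>0_def by blast
  have "0 = (\<Sum>d=1..x. F d * mangoldt d / real d)" by (simp add: F_zero)
  also have "\<dots> = (\<Sum>d=1..x. \<Sum>S\<in>Pow I. (\<Prod>i\<in>S. \<epsilon> i) * (\<psi> S d * mangoldt d / real d))"
    by (simp add: F_expand sum_distrib_right sum_divide_distrib mult.assoc)
  also have "\<dots> = (\<Sum>S\<in>Pow I. \<Sum>d=1..x. (\<Prod>i\<in>S. \<epsilon> i) * (\<psi> S d * mangoldt d / real d))"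
    by (rule sum.swap)
  also have "\<dots> = (\<Sum>S\<in>Pow I. (\<Prod>i\<in>S. \<epsilon> i) * (\<Sum>d=1..x. \<psi> S d * mangoldt d / real d))"
    by (simp add: sum_distrib_left)
  also have "\<dots> = (\<Sum>d=1..x. \<chi>0 d * mangoldt d / real d)
      + (\<Sum>S\<in>Pow I - {{}}. (\<Prod>i\<in>S. \<epsilon> i) * (\<Sum>d=1..x. \<psi> S d * mangoldt d / real d))"
    using I by (subst sum.remove[of _ "{}"]) (auto simp: \<psi>_def)
  finally have "(\<Sum>d=1..x. \<chi>0 d * mangoldt d / real d)
      = (\<Sum>S\<in>Pow I - {{}}. - ((\<Prod>i\<in>S. \<epsilon> i) * (\<Sum>d=1..x. \<psi> S d * mangoldt d / real d)))"
    by (simp add: sum_negf)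
  also have "\<dots> \<le> (\<Sum>S\<in>Pow I - {{}}. B S)"
  proof (intro sum_mono)
    fix S assume S: "S \<in> Pow I - {{}}"
    have "\<bar>\<Prod>i\<in>S. \<epsilon> i\<bar> = 1" unfolding abs_prod using S sign by (intro prod.neutral) fastforce
    then have "\<bar>(\<Prod>i\<in>S. \<epsilon> i) * (\<Sum>d=1..x. \<psi> S d * mangoldt d / real d)\<bar> \<le> B S"
      using B[OF S, of x] by (simp only: abs_mult mult_1)
    then show "- ((\<Prod>i\<in>S. \<epsilon> i) * (\<Sum>d=1..x. \<psi> S d * mangoldt d / real d)) \<le> B S" by linarith
  qed
  finally show False using x by simp
qed

section \<open>Legendre symbols and the characters modulo 4 and 8\<close>

lemma Legendre_mod_cong: "[a = b] (mod p) \<Longrightarrow> Legendre a p = Legendre b p"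
  by (simp add: Legendre_def QuadRes_def cong_def)

lemma Legendre_range: "Legendre a p \<in> {-1, 0, 1}"
  by (simp add: Legendre_def)

lemma Legendre_eq_0_iff: "Legendre a p = 0 \<longleftrightarrow> p dvd a"
  by (simp add: Legendre_def cong_0_iff)

lemma Legendre_1:
  assumes "1 < p"
  shows "Legendre 1 p = 1"
proof -
  have "\<not> [1 = 0] (mod p)" using assms by (simp add: cong_def)
  moreover have "QuadRes p 1" unfolding QuadRes_def by (rule exI[of _ 1]) simp
  ultimately show ?thesis by (simp add: Legendre_def)
qed

lemma Legendre_eqI:
  assumes "[a = b] (mod int p)" "2 < p" "a \<in> {-1, 0, 1}" "b \<in> {-1, 0, 1}"
  shows "a = b"
proof -
  have "int p dvd a - b" using assms(1) by (simp add: cong_iff_dvd_diff)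
  then have "a - b = 0 \<or> int p \<le> \<bar>a - b\<bar>" using dvd_imp_le_int[of "a - b" "int p"] by auto
  then show ?thesis using assms by auto
qed

lemma Legendre_mult:
  assumes "prime p" "2 < p"
  shows "Legendre (a * b) (int p) = Legendre a (int p) * Legendre b (int p)"
proof (rule Legendre_eqI[OF _ assms(2)])
  have "[Legendre (a * b) (int p) = (a * b) ^ ((p - 1) div 2)] (mod int p)"
    by (rule euler_criterion[OF assms])
  also have "(a * b) ^ ((p - 1) div 2) = a ^ ((p - 1) div 2) * b ^ ((p - 1) div 2)"
    by (rule power_mult_distrib)
  also have "[\<dots> = Legendre a (int p) * Legendre b (int p)] (mod int p)"
    by (intro cong_mult cong_sym[OF euler_criterion] assms)
  finally show "[Legendre (a * b) (int p) = Legendre a (int p) * Legendre b (int p)] (mod int p)" .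
  have "x * y \<in> {-1, 0, 1}" if "x \<in> {-1, 0, 1}" "y \<in> {-1, 0, 1}" for x y :: int
    using that by auto
  then show "Legendre a (int p) * Legendre b (int p) \<in> {-1, 0, 1}" using Legendre_range by blast
qed (rule Legendre_range)

lemma Legendre_minus_one:
  assumes "prime p" "2 < p"
  shows "Legendre (-1) (int p) = (if p mod 4 = 1 then 1 else -1)"
proof (rule Legendre_eqI[OF _ assms(2)])
  have "odd p" using assms prime_odd_nat by blast
  have "(-1::int) ^ ((p - 1) div 2) = (if p mod 4 = 1 then 1 else -1)"
  proof -
    have "even ((p - 1) div 2) \<longleftrightarrow> p mod 4 = 1" using \<open>odd p\<close> by presburger
    then show ?thesis by (simp add: uminus_power_if)
  qed
  then show "[Legendre (-1) (int p) = (if p mod 4 = 1 then 1 else -1)] (mod int p)"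
    using euler_criterion[OF assms, of "-1"] by simp
qed (rule Legendre_range, simp)

text \<open>Gauss's lemma for the multiplier 2. With p = 2h + 1, the doubles of 1, ..., h stay below
  p, so no reduction occurs, and those above h come from h div 2 < x \<le> h. The parity of their
  number depends on p mod 8.\<close>

lemma Legendre_two:
  assumes "prime p" "2 < p"
  shows "Legendre 2 (int p) = (if p mod 8 = 1 \<or> p mod 8 = 7 then 1 else -1)"
proof -
  have "odd p" using assms prime_odd_nat by blast
  interpret GAUSS p 2
    by unfold_locales (use assms in \<open>auto simp: cong_0_iff zdvd_not_zless\<close>)
  define h where "h = (p - 1) div 2"
  have p: "p = 2 * h + 1" using \<open>odd p\<close> assms by (auto simp: h_def)
  have E: "E = (\<lambda>x. 2 * int x) ` {h div 2 <.. h}"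
  proof (rule equalityI; rule subsetI)
    fix y assume "y \<in> E"
    then obtain x where "0 < x" "x \<le> (int p - 1) div 2" "y = (x * 2) mod int p" "(int p - 1) div 2 < y"
      unfolding E_def C_def B_def A_def by auto
    then have x: "0 < x" "x \<le> int h" "y = (x * 2) mod int p" "int h < y" by (simp_all add: p)
    then have "y = 2 * x" by (simp add: p)
    then show "y \<in> (\<lambda>x. 2 * int x) ` {h div 2 <.. h}"
      using x by (intro image_eqI[of _ _ "nat x"]) auto
  next
    fix y assume "y \<in> (\<lambda>x. 2 * int x) ` {h div 2 <.. h}"
    then obtain x where x: "h div 2 < x" "x \<le> h" "y = 2 * int x" by auto
    then have "y = int x * 2 mod int p" by (simp add: p)
    moreover have "int h < y" using x by linarith
    moreover have "(int p - 1) div 2 = int h" by (simp add: p)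
    moreover have "int x \<in> A" using x unfolding A_def by (simp add: p)
    ultimately show "y \<in> E" unfolding E_def C_def B_def by auto
  qed
  have card: "card E = h - h div 2"
    unfolding E by (subst card_image) (auto simp: inj_on_def)
  have "even (h - h div 2) \<longleftrightarrow> p mod 8 = 1 \<or> p mod 8 = 7" unfolding p by presburger
  then show ?thesis using gauss_lemma by (simp add: card uminus_power_if)
qed

text \<open>Without nonresidues, squaring would map the nonzero residues onto themselves and so be
  injective, but 1 and p - 1 have the same square.\<close>

lemma exists_nonresidue:
  assumes "prime p" "2 < p"
  shows "\<exists>a::nat. Legendre (int a) (int p) = -1"
proof (rule ccontr)
  assume neg: "\<not> ?thesis"
  define f where "f = (\<lambda>x::nat. x\<^sup>2 mod p)"
  have "{1..<p} \<subseteq> f ` {1..<p}"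
  proof
    fix a assume a: "a \<in> {1..<p}"
    then have "\<not> int p dvd int a" by (auto dest: nat_dvd_not_less)
    then have "QuadRes (int p) (int a)"
      using neg by (auto simp: Legendre_def cong_0_iff split: if_splits)
    then obtain y where y: "[y\<^sup>2 = int a] (mod int p)" by (auto simp: QuadRes_def)
    define x where "x = nat (y mod int p)"
    have x: "int x = y mod int p" "x < p" using assms by (auto simp: x_def nat_less_iff)
    have "int (x\<^sup>2 mod p) = y\<^sup>2 mod int p" by (simp add: zmod_int x(1) power_mod)
    also have "\<dots> = int a" using y a by (simp add: cong_def)
    finally have "f x = a" by (simp add: f_def)
    moreover have "x \<noteq> 0"
    proof
      assume "x = 0"
      then have "f x = 0" by (simp add: f_def)
      with \<open>f x = a\<close> a show False by simp
    qed
    ultimately show "a \<in> f ` {1..<p}" using x by auto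
  qed
  then have "inj_on f {1..<p}" by (intro eq_card_imp_inj_on antisym card_image_le card_mono) auto
  moreover have "f 1 = f (p - 1)"
  proof -
    have "(p - 1)\<^sup>2 = p * (p - 2) + 1"
      using assms(2) by (cases p) (auto simp: power2_eq_square algebra_simps)
    then have "f (p - 1) = 1 mod p" unfolding f_def by (simp only: mod_mult_self4)
    then show ?thesis by (simp add: f_def)
  qed
  ultimately have "1 = p - 1" by (rule inj_onD) (use assms in auto)
  then show False using assms by simp
qed

text \<open>The Jacobi symbol of -1 modulo an odd n, real-valued to serve as a character.\<close>

definition char4 :: "nat \<Rightarrow> real" where
  "char4 n = (if even n then 0 else if n mod 4 = 1 then 1 else -1)"

text \<open>The Jacobi symbol of 2 modulo an odd n.\<close>

definition char8 :: "nat \<Rightarrow> real" where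
  "char8 n = (if even n then 0 else if n mod 8 = 1 \<or> n mod 8 = 7 then 1 else -1)"

lemma char4_mult: "char4 (a * b) = char4 a * char4 b"
proof (cases "even a \<or> even b")
  case True
  have zero: "char4 n = 0" if "even n" for n using that by (simp only: char4_def if_True)
  have "even (a * b)" using True by simp
  then have "char4 (a * b) = 0" by (rule zero)
  moreover have "char4 a = 0 \<or> char4 b = 0" using True zero by blast
  ultimately show ?thesis by (auto simp only: mult_zero_left mult_zero_right)
next
  case False
  define g :: "nat \<Rightarrow> real" where "g = (\<lambda>r. if r = 1 then 1 else -1)"
  have g: "char4 n = g (n mod 4)" if "odd n" for n using that by (simp add: char4_def g_def)
  have "n mod 4 \<in> {1, 3}" if "odd n" for n :: nat
    using that by (simp only: insert_iff empty_iff) presburger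
  moreover have "\<forall>x\<in>{1, 3}. \<forall>y\<in>{1, 3}. g (x * y mod 4) = g x * g y"
    by (simp add: g_def)
  ultimately have "g ((a mod 4) * (b mod 4) mod 4) = g (a mod 4) * g (b mod 4)" using False by blast
  then show ?thesis using False by (simp add: g mod_mult_eq)
qed

lemma char8_mult: "char8 (a * b) = char8 a * char8 b"
proof (cases "even a \<or> even b")
  case True
  have zero: "char8 n = 0" if "even n" for n using that by (simp only: char8_def if_True)
  have "even (a * b)" using True by simp
  then have "char8 (a * b) = 0" by (rule zero)
  moreover have "char8 a = 0 \<or> char8 b = 0" using True zero by blast
  ultimately show ?thesis by (auto simp only: mult_zero_left mult_zero_right)
next
  case False
  define g :: "nat \<Rightarrow> real" where "g = (\<lambda>r. if r = 1 \<or> r = 7 then 1 else -1)"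
  have g: "char8 n = g (n mod 8)" if "odd n" for n using that by (simp add: char8_def g_def)
  have "n mod 8 \<in> {1, 3, 5, 7}" if "odd n" for n :: nat
    using that by (simp only: insert_iff empty_iff) presburger
  moreover have "\<forall>x\<in>{1, 3, 5, 7}. \<forall>y\<in>{1, 3, 5, 7}. g (x * y mod 8) = g x * g y"
    by (simp add: g_def)
  ultimately have "g ((a mod 8) * (b mod 8) mod 8) = g (a mod 8) * g (b mod 8)" using False by blast
  then show ?thesis using False by (simp add: g mod_mult_eq)
qed

text \<open>The condition q mod 4 = 1, imposed through \<open>char4\<close>, makes quadratic
  reciprocity symmetric, so that prescribing one symbol fixes the inverse one too.\<close>

theorem prime_with_prescribed_Legendre:
  fixes \<sigma> :: "nat \<Rightarrow> int" and \<eta> :: int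
  assumes P: "finite P" "\<And>p. p \<in> P \<Longrightarrow> prime p \<and> 2 < p"
    and \<sigma>: "\<And>p. p \<in> P \<Longrightarrow> \<sigma> p \<in> {-1, 1}" and \<eta>: "\<eta> \<in> {-1, 1}"
  obtains q where "prime q" "q mod 4 = 1" "Legendre 2 (int q) = \<eta>"
    "\<And>p. p \<in> P \<Longrightarrow> Legendre (int q) (int p) = \<sigma> p \<and> Legendre (int p) (int q) = \<sigma> p"
proof -
  \<comment> \<open>The auxiliary prime r outside P receives the sign -1, which the existence
    theorem demands of some character even if all given signs are 1.\<close>
  obtain r where r: "prime r" "Max (insert 2 P) < r" using bigger_prime by blast
  have r_gt: "x < r" if "x \<in> insert 2 P" for x
    using that r(2) P(1) by (meson Max_ge finite_insert le_less_trans)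
  define Q where "Q = insert r P"
  have Q: "finite Q" "\<And>p. p \<in> Q \<Longrightarrow> prime p \<and> 2 < p" and "r \<notin> P"
    using P r r_gt by (auto simp: Q_def)
  have Q': "1 \<notin> Q" "2 \<notin> Q" "Suc 0 \<notin> Q" using Q(2) by force+
  define K where "K = 8 * \<Prod>Q"
  \<comment> \<open>The indices 1 and 2 stand for the characters modulo 4 and 8; they are free
    because Q consists of odd primes.\<close>
  define \<chi> :: "nat \<Rightarrow> nat \<Rightarrow> real" where
    "\<chi> = (\<lambda>i n. if i = 1 then char4 n else if i = 2 then char8 n else of_int (Legendre (int n) (int i)))"
  have \<chi>_Q: "\<chi> p n = of_int (Legendre (int n) (int p))" if "p \<in> Q" for p n
    using that Q' by (auto simp: \<chi>_def)
  have \<chi>_1: "\<chi> 1 = char4" and \<chi>_2: "\<chi> 2 = char8" by (auto simp: \<chi>_def)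
  define \<epsilon> :: "nat \<Rightarrow> real" where
    "\<epsilon> = (\<lambda>i. if i = 1 then 1 else if i = 2 then of_int \<eta> else if i = r then -1 else of_int (\<sigma> i))"
  let ?I = "{1, 2} \<union> Q"
  have dvd_K: "p dvd K" if "p \<in> Q" for p
    unfolding K_def using that Q(1) by (intro dvd_mult dvd_prodI) auto
  have two_dvd_K: "2 dvd K" by (simp add: K_def)
  have Leg_1: "Legendre 1 (int p) = 1" if "p \<in> Q" for p
    using Q(2)[OF that] by (intro Legendre_1) simp
  have "\<exists>q. prime q \<and> coprime q K \<and> (\<forall>i\<in>?I. \<chi> i q = \<epsilon> i)"
  proof (rule prime_with_prescribed_characters[where k = r])
    show "0 < K" using Q by (auto simp: K_def intro!: prod_pos prime_gt_0_nat)
    fix i a b :: nat assume i: "i \<in> ?I"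
    show "\<chi> i (a * b) = \<chi> i a * \<chi> i b"
      using i Q(2) by (auto simp: \<chi>_1[simplified] \<chi>_2 char4_mult char8_mult \<chi>_Q Legendre_mult)
    show "\<chi> i (a + K) = \<chi> i a"
    proof -
      have "char4 (a + K) = char4 a" "char8 (a + K) = char8 a"
        unfolding K_def char4_def char8_def by (auto; presburger)+
      moreover have "Legendre (int (a + K)) (int i) = Legendre (int a) (int i)" if "i \<in> Q"
        using dvd_K[OF that] by (intro Legendre_mod_cong) (simp add: cong_iff_dvd_diff)
      ultimately show ?thesis using i by (auto simp: \<chi>_1[simplified] \<chi>_2 \<chi>_Q)
    qed
    show "\<chi> i a \<in> {-1, 0, 1}"
      using Legendre_range[of "int a" "int i"] by (auto simp: \<chi>_def char4_def char8_def)
    show "\<chi> i 1 = 1"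
      using i Q(2) by (auto simp: \<chi>_1[simplified] \<chi>_2 char4_def char8_def \<chi>_Q Leg_1)
    show "\<chi> i a \<noteq> 0" if "coprime a K"
    proof -
      have "odd a" using coprime_common_divisor[OF that _ two_dvd_K] by auto
      moreover have "\<not> p dvd a" if "p \<in> Q" for p
        using coprime_common_divisor[OF \<open>coprime a K\<close> _ dvd_K[OF that]] Q(2)[OF that] by auto
      ultimately show ?thesis
        using i by (auto simp: \<chi>_1[simplified] \<chi>_2 char4_def char8_def \<chi>_Q Legendre_eq_0_iff split: if_splits)
    qed
    show "\<epsilon> i \<in> {-1, 1}" using i \<sigma>[of i] \<eta> by (auto simp: \<epsilon>_def Q_def)
    show "\<exists>a. coprime a K \<and> \<chi> i a = -1 \<and> (\<forall>j\<in>?I - {i}. \<chi> j a = 1)"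
    proof -
      define m :: "nat \<Rightarrow> nat" where "m = (\<lambda>j. if j = 2 then 8 else j)"
      have "\<exists>u. \<forall>j\<in>Q. Legendre (int (u j)) (int j) = (if j = i then -1 else 1)"
      proof -
        have "\<exists>a. Legendre (int a) (int j) = (if j = i then -1 else 1)" if "j \<in> Q" for j
          using exists_nonresidue[of j] Legendre_1[of "int j"] Q(2)[OF that]
          by (cases "j = i") (auto intro: exI[of _ 1])
        then show ?thesis by metis
      qed
      then obtain u where u: "\<And>j. j \<in> Q \<Longrightarrow> Legendre (int (u j)) (int j) = (if j = i then -1 else 1)"
        by blast
      \<comment> \<open>Modulo 8, the residue 7 flips only \<open>char4\<close>, 5 flips only
        \<open>char8\<close>, and 1 flips neither. Index 2 carries this condition, hence the modulus
        8 in \<open>m\<close>.\<close>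
      define v :: "nat \<Rightarrow> nat" where "v = u(2 := if i = 1 then 7 else if i = 2 then 5 else 1)"
      have "\<exists>a. \<forall>j\<in>insert 2 Q. [a = v j] (mod m j)"
      proof (rule chinese_remainder_nat)
        show "\<forall>i\<in>insert 2 Q. \<forall>j\<in>insert 2 Q. i \<noteq> j \<longrightarrow> coprime (m i) (m j)"
        proof (intro ballI impI)
          fix i j assume ij: "i \<in> insert 2 Q" "j \<in> insert 2 Q" "i \<noteq> j"
          then have "coprime i j" using Q(2) by (auto intro!: primes_coprime)
          moreover have "coprime (8::nat) k" if "coprime 2 k" for k
            using coprime_power_left_iff[of 2 3 k] that by simp
          ultimately show "coprime (m i) (m j)"
            using ij coprime_commute[of i 2] coprime_commute[of i 8] by (auto simp: m_def)
        qed
      qed (use Q in auto)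
      then obtain a where a: "\<And>j. j \<in> insert 2 Q \<Longrightarrow> [a = v j] (mod m j)" by blast
      have a8: "a mod 8 = (if i = 1 then 7 else if i = 2 then 5 else 1)"
        using a[of 2] by (auto simp: v_def m_def cong_def split: if_splits)
      have aQ: "Legendre (int a) (int j) = (if j = i then -1 else 1)" if "j \<in> Q" for j
      proof -
        have "j \<noteq> 2" using that Q' by auto
        then have "[int a = int (u j)] (mod int j)" using a[of j] that by (simp add: v_def m_def cong_int_iff)
        from Legendre_mod_cong[OF this] u[OF that] show ?thesis by simp
      qed
      have "odd a" using a8 by (auto split: if_splits) presburger+
      have "coprime a p" if "p \<in> Q" for p
      proof -
        have "\<not> p dvd a" using aQ[OF that] Legendre_eq_0_iff[of "int a" "int p"] by (auto split: if_splits)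
        then show ?thesis using Q(2)[OF that] by (metis coprime_commute prime_imp_coprime_nat)
      qed
      then have "coprime a (\<Prod>Q)" by (rule prod_coprime_right)
      moreover have "coprime a 8"
        using \<open>odd a\<close> coprime_power_right_iff[of a 2 3] by simp
      ultimately have "coprime a K" by (simp add: K_def)
      moreover have c8: "char8 a = (if i = 2 then -1 else 1)"
        using a8 \<open>odd a\<close> by (auto simp: char8_def split: if_splits)
      moreover have c4: "char4 a = (if i = 1 then -1 else 1)"
      proof -
        have "a mod 4 = (a mod 8) mod 4" by (simp add: mod_mod_cancel)
        then show ?thesis using a8 \<open>odd a\<close> by (auto simp: char4_def split: if_splits)
      qed
      moreover have "\<chi> i a = -1" using i c4 c8 aQ \<chi>_Q by (auto simp: \<chi>_1[simplified] \<chi>_2)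
      moreover have "\<chi> j a = 1" if "j \<in> ?I - {i}" for j
        using that c4 c8 aQ \<chi>_Q by (auto simp: \<chi>_1[simplified] \<chi>_2)
      ultimately show ?thesis by blast
    qed
  qed (use Q Q' in \<open>auto simp: Q_def \<epsilon>_def\<close>)
  then obtain q where q: "prime q" "coprime q K" "\<And>i. i \<in> ?I \<Longrightarrow> \<chi> i q = \<epsilon> i" by blast
  have "odd q" using coprime_common_divisor[OF q(2) _ two_dvd_K] by auto
  have "char4 q = 1" using q(3)[of 1] by (simp add: \<chi>_def \<epsilon>_def)
  then have q4: "q mod 4 = 1" by (auto simp: char4_def split: if_splits)
  have "2 < q" using q(1) \<open>odd q\<close> by (metis le_neq_implies_less prime_ge_2_nat even_numeral)
  have q8: "Legendre 2 (int q) = \<eta>"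
    using q(3)[of 2] \<open>odd q\<close> by (auto simp: \<chi>_def \<epsilon>_def char8_def Legendre_two[OF q(1) \<open>2 < q\<close>] split: if_splits)
  have "Legendre (int q) (int p) = \<sigma> p \<and> Legendre (int p) (int q) = \<sigma> p" if "p \<in> P" for p
  proof -
    have p: "p \<in> Q" "prime p" "2 < p" "p \<noteq> r" using that P \<open>r \<notin> P\<close> by (auto simp: Q_def)
    have 1: "Legendre (int q) (int p) = \<sigma> p"
      using q(3)[of p] p Q' by (auto simp: \<chi>_Q \<epsilon>_def)
    have "q \<noteq> p" using 1 \<sigma>[OF that] Legendre_eq_0_iff[of "int q" "int p"] by auto
    have "even ((q - 1) div 2)" using q4 by presburger
    then have "Legendre (int p) (int q) * Legendre (int q) (int p) = 1"
      using Quadratic_Reciprocity[OF p(2,3) q(1) \<open>2 < q\<close>] \<open>q \<noteq> p\<close> by simp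
    then show ?thesis using 1 \<sigma>[OF that] by auto
  qed
  with q(1) q4 q8 show ?thesis by (rule that)
qed

section \<open>Rational and integral representations by ternary forms\<close>

lemma floor_sqrt_difference_square_le:
  fixes x y :: nat
  assumes "x \<le> floor_sqrt n" "y \<le> floor_sqrt n"
  shows "(int x - int y)\<^sup>2 \<le> int n"
proof -
  have "\<bar>int x - int y\<bar> \<le> int (floor_sqrt n)" using assms by simp
  then have "\<bar>int x - int y\<bar>\<^sup>2 \<le> (int (floor_sqrt n))\<^sup>2" by (rule power_mono) simp
  also have "\<dots> \<le> int n" using floor_sqrt_power2_le[of n] by (metis of_nat_le_iff of_nat_power)
  finally show ?thesis by simp
qed

lemma thue_lemma:
  fixes q :: nat and s d :: int
  assumes q: "0 < q" and s: "[s\<^sup>2 = - d] (mod int q)"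
  obtains y z :: int where "y \<noteq> 0 \<or> z \<noteq> 0" "y\<^sup>2 \<le> int q" "z\<^sup>2 \<le> int q" "int q dvd y\<^sup>2 + d * z\<^sup>2"
proof -
  define a where "a = floor_sqrt q"
  let ?f = "\<lambda>(y::nat, z::nat). (int y - s * int z) mod int q"
  let ?S = "{0..a} \<times> {0..a}"
  have "card (?f ` ?S) \<le> card {0..<int q}" using q by (intro card_mono) auto
  also have "\<dots> < card ?S"
    using Suc_floor_sqrt_power2_gt[of q] by (simp add: a_def power2_eq_square)
  finally have "\<not> inj_on ?f ?S" using pigeonhole by blast
  then obtain y1 z1 y2 z2 where h: "(y1, z1) \<in> ?S" "(y2, z2) \<in> ?S" "(y1, z1) \<noteq> (y2, z2)"
    "(int y1 - s * int z1) mod int q = (int y2 - s * int z2) mod int q"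
    unfolding inj_on_def by auto
  define y z where "y = int y1 - int y2" and "z = int z1 - int z2"
  have "int q dvd (int y1 - s * int z1) - (int y2 - s * int z2)"
    using h(4) by (simp add: mod_eq_dvd_iff)
  also have "\<dots> = y - s * z" by (simp add: y_def z_def algebra_simps)
  finally have "int q dvd (y - s * z) * (y + s * z)" by (rule dvd_mult2)
  moreover have "int q dvd (s\<^sup>2 - (- d)) * z\<^sup>2" using s by (simp add: cong_iff_dvd_diff)
  ultimately have "int q dvd (y - s * z) * (y + s * z) + (s\<^sup>2 - (- d)) * z\<^sup>2" by (rule dvd_add)
  also have "(y - s * z) * (y + s * z) + (s\<^sup>2 - (- d)) * z\<^sup>2 = y\<^sup>2 + d * z\<^sup>2"
    by (simp add: algebra_simps power2_eq_square)
  finally show ?thesis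
    using that[of y z] h(1-3) floor_sqrt_difference_square_le[of y1 q y2] floor_sqrt_difference_square_le[of z1 q z2]
    by (auto simp: y_def z_def a_def)
qed

text \<open>Pigeonhole in a box with more than NQ points: a difference of two points makes z^2 +
  Qt^2 - Nw^2 a multiple of NQ between -NQ and 2NQ. In the two extreme cases bounds are attained
  that would make Q a square. The multiple 0 is the goal, and the multiple NQ is converted into
  it.\<close>

lemma isotropic_small_solution:
  fixes N Q :: nat and r s :: int
  assumes N: "0 < N" and Q: "0 < Q" and cop: "coprime N Q" and nonsquare: "\<And>w::int. w\<^sup>2 \<noteq> int Q"
    and r: "[r\<^sup>2 = - int Q] (mod int N)" and s: "[s\<^sup>2 = int N] (mod int Q)"
  obtains z t w :: int where "w \<noteq> 0" "int N * w\<^sup>2 = z\<^sup>2 + int Q * t\<^sup>2"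
proof -
  define a b c where "a = floor_sqrt (N * Q)" and "b = floor_sqrt N" and "c = floor_sqrt Q"
  let ?f = "\<lambda>(z::nat, t::nat, w::nat). ((int z - r * int t) mod int N, (int z - s * int w) mod int Q)"
  let ?S = "{0..a} \<times> {0..b} \<times> {0..c}"
  have "card (?f ` ?S) \<le> card ({0..<int N} \<times> {0..<int Q})" using N Q by (intro card_mono) auto
  also have "\<dots> = N * Q" by simp
  also have "\<dots> < card ?S"
  proof -
    have "(N * Q)\<^sup>2 = (N * Q) * N * Q" by (simp add: power2_eq_square)
    also have "\<dots> < (Suc a)\<^sup>2 * (Suc b)\<^sup>2 * (Suc c)\<^sup>2"
      unfolding a_def b_def c_def by (intro mult_strict_mono Suc_floor_sqrt_power2_gt) auto
    also have "\<dots> = (Suc a * (Suc b * Suc c))\<^sup>2" by (simp only: power_mult_distrib mult.assoc)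
    also have "Suc a * (Suc b * Suc c) = card ?S" by (simp only: card_cartesian_product card_atLeastAtMost diff_zero)
    finally show ?thesis by (rule power2_less_imp_less) simp
  qed
  finally have "\<not> inj_on ?f ?S" using pigeonhole by blast
  then obtain z1 t1 w1 z2 t2 w2 where h: "(z1, t1, w1) \<in> ?S" "(z2, t2, w2) \<in> ?S"
    "(z1, t1, w1) \<noteq> (z2, t2, w2)" "?f (z1, t1, w1) = ?f (z2, t2, w2)"
    unfolding inj_on_def by auto
  define z t w where "z = int z1 - int z2" and "t = int t1 - int t2" and "w = int w1 - int w2"
  have nz: "z \<noteq> 0 \<or> t \<noteq> 0 \<or> w \<noteq> 0" using h(3) by (auto simp: z_def t_def w_def)
  have z: "z\<^sup>2 \<le> int N * int Q" and t: "t\<^sup>2 \<le> int N" and w: "w\<^sup>2 \<le> int Q"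
    using h(1,2) floor_sqrt_difference_square_le[of z1 "N * Q" z2] floor_sqrt_difference_square_le[of t1 N t2] floor_sqrt_difference_square_le[of w1 Q w2]
    by (auto simp: z_def t_def w_def a_def b_def c_def)
  let ?E = "z\<^sup>2 + int Q * t\<^sup>2 - int N * w\<^sup>2"
  have "int N dvd ?E"
  proof -
    have "int N dvd (int z1 - r * int t1) - (int z2 - r * int t2)"
      using h(4) by (simp add: mod_eq_dvd_iff)
    also have "\<dots> = z - r * t" by (simp add: z_def t_def algebra_simps)
    finally have "int N dvd (z - r * t) * (z + r * t)" by (rule dvd_mult2)
    moreover have "int N dvd (r\<^sup>2 - (- int Q)) * t\<^sup>2 - int N * w\<^sup>2"
      using r by (intro dvd_diff) (simp_all add: cong_iff_dvd_diff)
    ultimately have "int N dvd (z - r * t) * (z + r * t) + ((r\<^sup>2 - (- int Q)) * t\<^sup>2 - int N * w\<^sup>2)"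
      by (rule dvd_add)
    also have "\<dots> = ?E" by (simp add: algebra_simps power2_eq_square)
    finally show ?thesis .
  qed
  have "int Q dvd ?E"
  proof -
    have "int Q dvd (int z1 - s * int w1) - (int z2 - s * int w2)"
      using h(4) by (simp add: mod_eq_dvd_iff)
    also have "\<dots> = z - s * w" by (simp add: z_def w_def algebra_simps)
    finally have "int Q dvd (z - s * w) * (z + s * w)" by (rule dvd_mult2)
    moreover have "int Q dvd (s\<^sup>2 - int N) * w\<^sup>2 + int Q * t\<^sup>2"
      using s by (intro dvd_add) (simp_all add: cong_iff_dvd_diff)
    ultimately have "int Q dvd (z - s * w) * (z + s * w) + ((s\<^sup>2 - int N) * w\<^sup>2 + int Q * t\<^sup>2)"
      by (rule dvd_add)
    also have "\<dots> = ?E" by (simp add: algebra_simps power2_eq_square)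
    finally show ?thesis .
  qed
  have "int N * int Q dvd ?E"
    using \<open>int N dvd ?E\<close> \<open>int Q dvd ?E\<close> cop by (intro divides_mult) auto
  then obtain k where k: "?E = int N * int Q * k" by (elim dvdE)
  define M where "M = int N * int Q"
  have M: "0 < M" using N Q by (simp add: M_def)
  have t': "int Q * t\<^sup>2 \<le> M" using mult_left_mono[OF t, of "int Q"] by (simp add: M_def mult.commute)
  have w': "int N * w\<^sup>2 \<le> M" using w by (simp add: M_def mult_left_mono)
  have nn: "0 \<le> int Q * t\<^sup>2" "0 \<le> int N * w\<^sup>2" "0 \<le> z\<^sup>2" by auto
  have "M * k \<le> M * 2" using z t' nn k unfolding M_def[symmetric] by linarith
  then have "k \<le> 2" using M by simp
  have "M * (-1) \<le> M * k" using w' nn k unfolding M_def[symmetric] by linarith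
  then have "-1 \<le> k" using M by (subst (asm) mult_le_cancel_left_pos)
  consider "k = -1" | "k = 0" | "k = 1" | "k = 2" using \<open>k \<le> 2\<close> \<open>-1 \<le> k\<close> by linarith
  then show ?thesis
  proof cases
    case 1
    then have "?E = - M" using k by (simp add: M_def)
    then have "int N * w\<^sup>2 = M" using w' nn by linarith
    then have "w\<^sup>2 = int Q" using N by (simp add: M_def)
    then show ?thesis using nonsquare by blast
  next
    case 2
    have "w \<noteq> 0"
    proof
      assume "w = 0"
      then have "z\<^sup>2 + int Q * t\<^sup>2 = 0" using k 2 by simp
      then have "z\<^sup>2 = 0" "int Q * t\<^sup>2 = 0" using nn by linarith+
      then show False using nz \<open>w = 0\<close> Q by simp
    qed
    then show ?thesis using that[of w z t] k 2 by simp
  next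
    case 3
    \<comment> \<open>Multiply by the norm \<open>w\<^sup>2 + Q\<close> and use multiplicativity of the form \<open>z\<^sup>2 + Q t\<^sup>2\<close>.\<close>
    have e: "z\<^sup>2 + int Q * t\<^sup>2 = int N * (w\<^sup>2 + int Q)" using k 3 by (simp add: algebra_simps)
    have "int N * (w\<^sup>2 + int Q)\<^sup>2 = (int N * (w\<^sup>2 + int Q)) * (w\<^sup>2 + int Q)"
      by (simp add: power2_eq_square)
    also have "\<dots> = (z * w + int Q * t)\<^sup>2 + int Q * (z - t * w)\<^sup>2"
      unfolding e[symmetric] by (simp add: algebra_simps power2_eq_square)
    finally have "int N * (w\<^sup>2 + int Q)\<^sup>2 = \<dots>" .
    moreover have "w\<^sup>2 + int Q \<noteq> 0" using Q by (simp add: add_nonneg_eq_0_iff)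
    ultimately show ?thesis using that by blast
  next
    case 4
    then have "?E = 2 * M" using k by (simp add: M_def)
    then have zt: "z\<^sup>2 = M" "int Q * t\<^sup>2 = M" using w' nn z t' unfolding M_def[symmetric] by linarith+
    then have "t\<^sup>2 = int N" using Q by (simp add: M_def)
    with zt have zt2: "z\<^sup>2 = t\<^sup>2 * int Q" by (simp add: M_def)
    then have "t\<^sup>2 dvd z\<^sup>2" by simp
    then have "t dvd z" by simp
    then obtain m where "z = t * m" by blast
    moreover have "t \<noteq> 0" using \<open>t\<^sup>2 = int N\<close> N by auto
    ultimately have "m\<^sup>2 = int Q" using zt2 by (simp add: power_mult_distrib)
    then show ?thesis using nonsquare by blast
  qed
qed

lemma quadratic_residue_prod_primes:
  fixes P :: "nat set"
  assumes "finite P" "\<And>p. p \<in> P \<Longrightarrow> prime p" "\<And>p. p \<in> P \<Longrightarrow> QuadRes (int p) a"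
  shows "\<exists>r. [r\<^sup>2 = a] (mod int (\<Prod>P))"
  using assms
proof (induction P rule: finite_induct)
  case (insert p P)
  then obtain r where r: "[r\<^sup>2 = a] (mod int (\<Prod>P))" by auto
  obtain s where s: "[s\<^sup>2 = a] (mod int p)" using insert.prems by (auto simp: QuadRes_def)
  have cop: "coprime (int p) (int (\<Prod>P))"
    using insert by (simp only: coprime_int_iff) (intro prod_coprime_right primes_coprime, auto)
  obtain x where x: "[x = s] (mod int p)" "[x = r] (mod int (\<Prod>P))"
    using binary_chinese_remainder_int[OF cop] by blast
  have "[x\<^sup>2 = a] (mod int p)" "[x\<^sup>2 = a] (mod int (\<Prod>P))"
    using cong_trans[OF cong_pow[OF x(1)] s] cong_trans[OF cong_pow[OF x(2)] r] by auto
  then have "[x\<^sup>2 = a] (mod (int p * int (\<Prod>P)))" using cop by (intro coprime_cong_mult)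
  then show ?case using insert.hyps by auto
qed auto

text \<open>The descent of Davenport and Cassels: reflecting a rational point on the quadric in a
  nearby lattice point strictly decreases its denominator.\<close>

lemma davenport_cassels:
  fixes e :: int
  assumes e: "e \<in> {0, 1}"
  defines "F \<equiv> \<lambda>(x, y, z). x\<^sup>2 + y\<^sup>2 + e * y * z + z\<^sup>2"
  assumes "0 < t" "N * t\<^sup>2 = F (u1, u2, u3)"
  shows "\<exists>x y z. N = F (x, y, z)"
  using assms(3,4)
proof (induction "nat t" arbitrary: t u1 u2 u3 rule: less_induct)
  case less
  have round: "\<exists>y. \<bar>2 * (m - t * y)\<bar> \<le> t" for m
  proof -
    define y where "y = (2 * m + t) div (2 * t)"
    have "(2 * m + t) mod (2 * t) = 2 * m + t - 2 * t * y" unfolding y_def by (simp add: minus_mult_div_eq_mod)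
    moreover have "0 \<le> (2 * m + t) mod (2 * t)" "(2 * m + t) mod (2 * t) < 2 * t" using less.prems(1) by auto
    ultimately have "\<bar>2 * (m - t * y)\<bar> \<le> t" by (simp add: algebra_simps)
    then show ?thesis ..
  qed
  obtain y1 where y1: "\<bar>2 * (u1 - t * y1)\<bar> \<le> t" using round by blast
  obtain y3 where y3: "\<bar>2 * (u3 - t * y3)\<bar> \<le> t" using round by blast
  define r1 r3 where "r1 = u1 - t * y1" and "r3 = u3 - t * y3"
  \<comment> \<open>The second coordinate is rounded last and with the shift \<open>e * r3\<close>,
    because the completed square \<open>2 * r2 + e * r3\<close> has to be small. The three squares
    in 4R are then at most t^2 each, so R < t^2.\<close>
  obtain y2 where y2: "\<bar>2 * (u2 - t * y2) + e * r3\<bar> \<le> t"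
  proof -
    obtain y where y: "\<bar>2 * ((2 * u2 + e * r3) - (2 * t) * y)\<bar> \<le> 2 * t"
    proof -
      define y where "y = (2 * u2 + e * r3 + t) div (2 * t)"
      have "(2 * u2 + e * r3 + t) mod (2 * t) = 2 * u2 + e * r3 + t - 2 * t * y"
        unfolding y_def by (simp add: minus_mult_div_eq_mod)
      moreover have "0 \<le> (2 * u2 + e * r3 + t) mod (2 * t)" "(2 * u2 + e * r3 + t) mod (2 * t) < 2 * t"
        using less.prems(1) by auto
      ultimately have "\<bar>2 * ((2 * u2 + e * r3) - (2 * t) * y)\<bar> \<le> 2 * t" by (simp add: algebra_simps)
      then show ?thesis by (rule that)
    qed
    then show ?thesis by (intro that[of y]) (simp add: algebra_simps)
  qed
  define r2 where "r2 = u2 - t * y2"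
  define R Y where "R = F (r1, r2, r3)" and "Y = F (y1, y2, y3)"
  define B where "B = 2 * u1 * y1 + 2 * u2 * y2 + e * (u2 * y3 + u3 * y2) + 2 * u3 * y3"
  \<comment> \<open>The new denominator R/t, written out so that it is visibly an integer.\<close>
  define t' where "t' = t * N - B + t * Y"
  have R_eq: "R = t * t'"
  proof -
    have "R = F (u1, u2, u3) - t * B + t\<^sup>2 * Y"
      by (simp add: R_def F_def B_def Y_def r1_def r2_def r3_def algebra_simps power2_eq_square)
    then show ?thesis unfolding less.prems(2)[symmetric] t'_def by (simp add: algebra_simps power2_eq_square)
  qed
  have R4: "4 * R = (2 * r1)\<^sup>2 + (2 * r2 + e * r3)\<^sup>2 + (4 - e) * r3\<^sup>2"
    using e by (auto simp: R_def F_def power2_sum power_mult_distrib algebra_simps)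
  have "(2 * r1)\<^sup>2 \<le> t\<^sup>2" "(2 * r2 + e * r3)\<^sup>2 \<le> t\<^sup>2" "(2 * r3)\<^sup>2 \<le> t\<^sup>2"
    using y1 y2 y3 less.prems(1) by (simp_all only: r1_def r2_def r3_def abs_le_square_iff[symmetric] abs_of_pos)
  moreover have "(4 - e) * r3\<^sup>2 \<le> (2 * r3)\<^sup>2" "0 \<le> (4 - e) * r3\<^sup>2"
    using e by (auto simp: power_mult_distrib)
  moreover have "0 < t\<^sup>2" using less.prems(1) by simp
  ultimately have R_lt: "R < t\<^sup>2" and R_ge: "0 \<le> R" using R4 zero_le_power2[of "2 * r1"] zero_le_power2[of "2 * r2 + e * r3"] by linarith+
  show ?case
  proof (cases "R = 0")
    case True
    then have "(2 * r1)\<^sup>2 + (2 * r2 + e * r3)\<^sup>2 + (4 - e) * r3\<^sup>2 = 0" using R4 by simp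
    moreover have "0 \<le> (2 * r1)\<^sup>2" "0 \<le> (2 * r2 + e * r3)\<^sup>2" by auto
    ultimately have "(2 * r1)\<^sup>2 = 0" "(2 * r2 + e * r3)\<^sup>2 = 0" "(4 - e) * r3\<^sup>2 = 0"
      using \<open>0 \<le> (4 - e) * r3\<^sup>2\<close> by linarith+
    then have "r1 = 0" "r3 = 0" "r2 = 0" using e by auto
    then have "u1 = t * y1" "u2 = t * y2" "u3 = t * y3" by (simp_all add: r1_def r2_def r3_def)
    then have "N * t\<^sup>2 = Y * t\<^sup>2"
      using less.prems(2) by (simp add: F_def Y_def algebra_simps power2_eq_square)
    then have "N = Y" using less.prems(1) by simp
    then show ?thesis unfolding Y_def by blast
  next
    case False
    then have "0 < R" using R_ge by simp
    then have t'_pos: "0 < t'" using R_eq less.prems(1) by (simp add: zero_less_mult_iff)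
    have "t * t' < t * t" using R_lt R_eq by (simp add: power2_eq_square)
    then have "t' < t" using less.prems(1) by simp
    \<comment> \<open>The line through the lattice point y and the rational point u/t meets the
      quadric again at y + (D/t')r: along y + sr the product of the two parameters is D/R, and u/t
      has parameter 1/t.\<close>
    define D where "D = Y - N"
    have bil: "2 * y1 * r1 + 2 * y2 * r2 + e * (y2 * r3 + y3 * r2) + 2 * y3 * r3 = - t * D - t'"
    proof -
      have "2 * y1 * r1 + 2 * y2 * r2 + e * (y2 * r3 + y3 * r2) + 2 * y3 * r3 = B - 2 * t * Y"
        by (simp add: r1_def r2_def r3_def B_def Y_def F_def algebra_simps power2_eq_square)
      then show ?thesis by (simp add: t'_def D_def algebra_simps)
    qed
    have "F (t' * y1 + D * r1, t' * y2 + D * r2, t' * y3 + D * r3)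
        = t'\<^sup>2 * Y + t' * D * (2 * y1 * r1 + 2 * y2 * r2 + e * (y2 * r3 + y3 * r2) + 2 * y3 * r3) + D\<^sup>2 * R"
      by (simp add: F_def Y_def R_def algebra_simps power2_eq_square)
    also have "\<dots> = N * t'\<^sup>2"
      unfolding bil R_eq by (simp add: D_def algebra_simps power2_eq_square)
    finally have "N * t'\<^sup>2 = F (t' * y1 + D * r1, t' * y2 + D * r2, t' * y3 + D * r3)" by simp
    moreover have "nat t' < nat t" using \<open>t' < t\<close> t'_pos by simp
    ultimately show ?thesis using less.hyps t'_pos by blast
  qed
qed

section \<open>Towards three squares: symbols of products and primes as values of binary
  forms\<close>

lemma QuadRes_if_Legendre: "Legendre a p = 1 \<Longrightarrow> QuadRes p a"
  by (auto simp: Legendre_def split: if_splits)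

lemma QuadRes_2: "QuadRes 2 a"
proof -
  have "[a\<^sup>2 = a] (mod 2)" by (simp add: cong_iff_dvd_diff)
  then show ?thesis unfolding QuadRes_def by blast
qed

lemma Legendre_prod:
  assumes "prime q" "2 < q" "finite P"
  shows "Legendre (int (\<Prod>P)) (int q) = (\<Prod>p\<in>P. Legendre (int p) (int q))"
  using assms(3)
proof (induction P rule: finite_induct)
  case (insert p P)
  have "int (\<Prod>(insert p P)) = int p * int (\<Prod>P)" using insert.hyps by simp
  then have "Legendre (int (\<Prod>(insert p P))) (int q) = Legendre (int p) (int q) * Legendre (int (\<Prod>P)) (int q)"
    by (simp only: Legendre_mult[OF assms(1,2)])
  also have "\<dots> = (\<Prod>p\<in>insert p P. Legendre (int p) (int q))"
    unfolding insert.IH using insert.hyps by simp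
  finally show ?case .
next
  case empty
  show ?case using Legendre_1[of "int q"] assms(2) by simp
qed

lemma char4_prod:
  assumes "finite P" "\<And>p. p \<in> P \<Longrightarrow> prime p \<and> 2 < p"
  shows "char4 (\<Prod>P) = of_int (\<Prod>p\<in>P. Legendre (-1) (int p))"
  using assms
proof (induction P rule: finite_induct)
  case (insert p P)
  have p: "prime p" "2 < p" "odd p" using insert.prems[of p] prime_odd_nat by auto
  then have "char4 p = of_int (Legendre (-1) (int p))"
    unfolding Legendre_minus_one[OF p(1,2)] by (simp add: char4_def)
  with insert show ?case by (simp add: char4_mult)
qed (simp add: char4_def)

lemma char8_prod:
  assumes "finite P" "\<And>p. p \<in> P \<Longrightarrow> prime p \<and> 2 < p"
  shows "char8 (\<Prod>P) = of_int (\<Prod>p\<in>P. Legendre 2 (int p))"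
  using assms
proof (induction P rule: finite_induct)
  case (insert p P)
  have p: "prime p" "2 < p" "odd p" using insert.prems[of p] prime_odd_nat by auto
  then have "char8 p = of_int (Legendre 2 (int p))"
    unfolding Legendre_two[OF p(1,2)] by (simp add: char8_def)
  with insert show ?case by (simp add: char8_mult)
qed (simp add: char8_def)

lemma prod_prime_factors_squarefree:
  assumes "squarefree (n::nat)"
  shows "\<Prod>(prime_factors n) = n"
proof -
  have "n \<noteq> 0" using assms by (intro notI) simp
  then have "(\<Prod>p\<in>prime_factors n. p ^ multiplicity p n) = n" by (simp add: prod_prime_factors)
  moreover have "multiplicity p n = 1" if p: "p \<in> prime_factors n" for p
  proof (rule antisym)
    have "prime p" "0 < multiplicity p n" using p by (auto simp: prime_factors_multiplicity)
    then show "multiplicity p n \<le> 1" "1 \<le> multiplicity p n"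
      using squarefree_factorial_semiring''[OF \<open>n \<noteq> 0\<close>] assms by auto
  qed
  ultimately show ?thesis by simp
qed

lemma small_multiple_of_prime_not_square:
  assumes "prime q" "2 < q" "c \<in> {1, 2}"
  shows "w\<^sup>2 \<noteq> int (c * q)"
proof
  assume w: "w\<^sup>2 = int (c * q)"
  have pq: "prime (int q)" using assms(1) by simp
  have "int q dvd w\<^sup>2" by (simp add: w)
  then have "int q dvd w" using pq prime_dvd_power by blast
  then have "(int q)\<^sup>2 dvd w\<^sup>2" by simp
  then have "int q * int q dvd int q * int c" unfolding w by (simp add: power2_eq_square mult.commute)
  then have "int q dvd int c" using assms(2) by simp
  then have "int q \<le> int c" using assms(3) by (intro zdvd_imp_le) auto
  then show False using assms(2,3) by auto
qed

lemma two_squares: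
  assumes "prime q" "q mod 4 = 1"
  obtains u v :: int where "int q = u\<^sup>2 + v\<^sup>2"
proof -
  have q2: "2 < q" using assms prime_ge_2_nat[of q] by (cases "q = 2") auto
  have "Legendre (-1) (int q) = 1" using assms Legendre_minus_one[OF assms(1) q2] by simp
  then obtain s where s: "[s\<^sup>2 = - 1] (mod int q)" using QuadRes_if_Legendre unfolding QuadRes_def by blast
  obtain y z where yz: "y \<noteq> 0 \<or> z \<noteq> 0" "y\<^sup>2 \<le> int q" "z\<^sup>2 \<le> int q" "int q dvd y\<^sup>2 + 1 * z\<^sup>2"
    using thue_lemma[OF _ s] q2 by auto
  have "y\<^sup>2 \<noteq> int q" using small_multiple_of_prime_not_square[OF assms(1) q2, of 1 y] by simp
  then have lt: "y\<^sup>2 + z\<^sup>2 < int q * 2" using yz by linarith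
  have pos: "0 < y\<^sup>2 + z\<^sup>2" using yz(1) by (simp add: sum_power2_gt_zero_iff)
  obtain k where k: "y\<^sup>2 + z\<^sup>2 = int q * k" using yz(4) by (auto elim: dvdE)
  have "k < 2" using lt unfolding k using q2 by simp
  moreover have "0 < k" using pos q2 unfolding k by (simp add: zero_less_mult_iff)
  ultimately have "k = 1" by simp
  then show ?thesis using that[of y z] k by simp
qed

text \<open>Thue's lemma leaves y^2 + 3z^2 = kq with 0 < k < 4. The value k = 2 fails modulo 4, and
  k = 3 makes y divisible by 3, which turns the equation into a representation of q.\<close>

lemma square_plus_three_squares:
  assumes "prime q" "3 < q" "Legendre (-3) (int q) = 1"
  obtains u v :: int where "int q = u\<^sup>2 + 3 * v\<^sup>2"
proof -
  obtain s where s: "[s\<^sup>2 = - 3] (mod int q)" using QuadRes_if_Legendre[OF assms(3)] unfolding QuadRes_def by blast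
  obtain y z where yz: "y \<noteq> 0 \<or> z \<noteq> 0" "y\<^sup>2 \<le> int q" "z\<^sup>2 \<le> int q" "int q dvd y\<^sup>2 + 3 * z\<^sup>2"
    using thue_lemma[OF _ s] assms(2) by auto
  have "y\<^sup>2 \<noteq> int q" using small_multiple_of_prime_not_square[OF assms(1), of 1 y] assms(2) by simp
  then have lt: "y\<^sup>2 + 3 * z\<^sup>2 < int q * 4" using yz by linarith
  have pos: "0 < y\<^sup>2 + 3 * z\<^sup>2" using yz(1) zero_less_power2[of y] zero_less_power2[of z] zero_le_power2[of y] zero_le_power2[of z] by (smt (verit))
  obtain k where k: "y\<^sup>2 + 3 * z\<^sup>2 = int q * k" using yz(4) by (auto elim: dvdE)
  have "k < 4" using lt assms(2) unfolding k by simp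
  moreover have "0 < k" using pos assms(2) unfolding k by (simp add: zero_less_mult_iff)
  ultimately consider "k = 1" | "k = 2" | "k = 3" by linarith
  then show ?thesis
  proof cases
    case 1
    then show ?thesis using that[of y z] k by simp
  next
    case 2
    have "odd q" using assms prime_odd_nat by auto
    have "even y \<longleftrightarrow> even z"
    proof -
      have "even (y\<^sup>2 + 3 * z\<^sup>2)" using k 2 by simp
      then show ?thesis by simp
    qed
    then have "even (y - z)" by simp
    then obtain a where "y - z = 2 * a" by (elim evenE)
    then have a: "y = z + 2 * a" by simp
    have "4 dvd y\<^sup>2 + 3 * z\<^sup>2"
      unfolding a by (rule dvdI[of _ _ "z\<^sup>2 + z * a + a\<^sup>2"]) (simp add: algebra_simps power2_eq_square)
    then have "4 dvd int q * 2" using k 2 by simp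
    then have "even (int q)" by presburger
    then show ?thesis using \<open>odd q\<close> by simp
  next
    case 3
    have "3 dvd y\<^sup>2"
    proof -
      have "y\<^sup>2 = 3 * (int q - z\<^sup>2)" using k 3 by simp
      then show ?thesis by simp
    qed
    then have "3 dvd y" by (rule prime_dvd_power[rotated]) simp
    then obtain a where "y = 3 * a" by blast
    then have "int q = z\<^sup>2 + 3 * a\<^sup>2" using k 3 by (simp add: power_mult_distrib)
    then show ?thesis by (rule that)
  qed
qed

text \<open>As N is squarefree, the Chinese remainder theorem splits both congruences into
  conditions at single primes. At odd primes these are the Legendre symbols; modulo 2 every integer
  is a square.\<close>

lemma isotropic_small_solution_prime:
  fixes N q c :: nat
  assumes N: "squarefree N" and q: "prime q" "2 < q" and c: "c \<in> {1, 2}" "c = 2 \<longrightarrow> odd N"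
    and NQ: "\<And>p. p \<in> prime_factors N - {2} \<Longrightarrow> Legendre (- int (c * q)) (int p) = 1"
    and QN: "Legendre (int N) (int q) = 1"
  obtains z t w :: int where "w \<noteq> 0" "int N * w\<^sup>2 = z\<^sup>2 + int (c * q) * t\<^sup>2"
proof (rule isotropic_small_solution)
  show "0 < N" using N by (auto intro: Nat.gr0I)
  show "0 < c * q" using q c by auto
  have "\<not> int q dvd int N" using QN Legendre_eq_0_iff[of "int N" "int q"] by auto
  then have "coprime q N" using q(1) prime_imp_coprime_nat by auto
  moreover have "coprime c N" using c by auto
  ultimately show "coprime N (c * q)" by (simp add: coprime_commute)
  show "w\<^sup>2 \<noteq> int (c * q)" for w by (rule small_multiple_of_prime_not_square[OF q c(1)])
  have "\<exists>r. [r\<^sup>2 = - int (c * q)] (mod int (\<Prod>(prime_factors N)))"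
  proof (rule quadratic_residue_prod_primes)
    fix p assume p: "p \<in> prime_factors N"
    then show "prime p" by auto
    show "QuadRes (int p) (- int (c * q))"
      using p QuadRes_2 QuadRes_if_Legendre[OF NQ[of p]] by (cases "p = 2") auto
  qed simp
  then show "[(SOME r. [r\<^sup>2 = - int (c * q)] (mod int N))\<^sup>2 = - int (c * q)] (mod int N)"
    unfolding prod_prime_factors_squarefree[OF N] by (rule someI_ex)
  have "\<exists>s. [s\<^sup>2 = int N] (mod int (\<Prod>(if c = 1 then {q} else {2, q})))"
    by (rule quadratic_residue_prod_primes)
       (use q QuadRes_2 QuadRes_if_Legendre[OF QN] in \<open>auto split: if_splits\<close>)
  also have "\<Prod>(if c = 1 then {q} else {2, q}) = c * q" using c q by auto
  finally show "[(SOME s. [s\<^sup>2 = int N] (mod int (c * q)))\<^sup>2 = int N] (mod int (c * q))"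
    by (rule someI_ex)
qed

lemma ternary_form_represents:
  fixes e :: int
  assumes e: "e \<in> {0, 1}" and w: "w \<noteq> 0" "N * w\<^sup>2 = z\<^sup>2 + Q * t\<^sup>2" and Q: "Q = a\<^sup>2 + e * a * b + b\<^sup>2"
  shows "\<exists>x y z. N = x\<^sup>2 + y\<^sup>2 + e * y * z + z\<^sup>2"
proof -
  have "N * \<bar>w\<bar>\<^sup>2 = z\<^sup>2 + (a * t)\<^sup>2 + e * (a * t) * (b * t) + (b * t)\<^sup>2"
    using w(2) by (simp add: Q algebra_simps power2_eq_square)
  then show ?thesis using davenport_cassels[OF e, of "\<bar>w\<bar>" N z "a * t" "b * t"] w(1) by auto
qed

text \<open>Prescribing (q/p) = (-c/p) at the odd primes p dividing N makes -cq a square modulo N.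
  By reciprocity (N/q) is the product of these signs, times (2/q) if N is even. For odd N the choice
  of c makes the product 1; for even N the value (2/q) is at disposal and is set equal to the
  product.\<close>

lemma three_squares_squarefree:
  fixes N :: nat
  assumes N: "squarefree N" and mod8: "N mod 8 \<in> {1, 2, 3, 5, 6}"
  shows "\<exists>x y z :: int. int N = x\<^sup>2 + y\<^sup>2 + z\<^sup>2"
proof -
  define P where "P = prime_factors N - {2}"
  have "2 < p" if "prime p" "p \<noteq> 2" for p :: nat using that prime_ge_2_nat[of p] by simp
  then have P: "finite P" "\<And>p. p \<in> P \<Longrightarrow> prime p \<and> 2 < p"
    unfolding P_def by auto
  define M where "M = \<Prod>P"
  define c :: nat where "c = (if N mod 8 = 3 then 2 else 1)"
  have N_eq: "N = (if even N then 2 else 1) * M"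
  proof (cases "even N")
    case True
    have "N \<noteq> 0" using N by (intro notI) simp
    then have "2 \<in> prime_factors N" using True by (auto simp: prime_factors_dvd)
    then show ?thesis
      using prod.remove[of "prime_factors N" 2 "\<lambda>p. p"] True
      by (simp add: M_def P_def prod_prime_factors_squarefree[OF N])
  next
    case False
    then have "2 \<notin> prime_factors N" by (auto simp: prime_factors_dvd)
    then show ?thesis using False by (simp add: M_def P_def prod_prime_factors_squarefree[OF N])
  qed
  have "odd M"
  proof
    assume "even M"
    then have "\<exists>p\<in>P. 2 dvd p" unfolding M_def using P(1) by (simp add: prime_dvd_prod_iff)
    then show False using P(2) prime_odd_nat by blast
  qed
  define \<sigma> where "\<sigma> = (\<lambda>p::nat. if c = 2 then Legendre (-2) (int p) else Legendre (-1) (int p))"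
  have \<sigma>: "\<sigma> p \<in> {-1, 1}" if "p \<in> P" for p
  proof -
    have p: "prime p" "2 < p" using P(2)[OF that] by auto
    have "\<not> int p dvd -2" using p(2) zdvd_imp_le[of "int p" 2] by auto
    moreover have "\<not> int p dvd -1" using p(2) zdvd_imp_le[of "int p" 1] by auto
    ultimately show ?thesis
      using Legendre_range[of "-1" "int p"] Legendre_range[of "-2" "int p"]
      by (auto simp: \<sigma>_def Legendre_eq_0_iff[symmetric])
  qed
  define \<eta> where "\<eta> = (\<Prod>p\<in>P. \<sigma> p)"
  have \<eta>: "\<eta> \<in> {-1, 1}"
    unfolding \<eta>_def using P(1) \<sigma>
  proof (induction P rule: finite_induct)
    case (insert p P)
    then have "(\<Prod>p\<in>P. \<sigma> p) \<in> {-1, 1}" "\<sigma> p \<in> {-1, 1}" by auto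
    then show ?case using insert.hyps by auto
  qed auto
  have \<eta>_odd: "\<eta> = 1" if "odd N"
  proof (cases "c = 2")
    case True
    then have "M mod 8 = 3" using N_eq that by (auto simp: c_def split: if_splits)
    then have "M mod 4 = 3" by presburger
    have "\<sigma> p = Legendre (-1) (int p) * Legendre 2 (int p)" if "p \<in> P" for p
      using Legendre_mult[of p "-1" 2] P(2)[OF that] True by (simp add: \<sigma>_def)
    then have "\<eta> = (\<Prod>p\<in>P. Legendre (-1) (int p)) * (\<Prod>p\<in>P. Legendre 2 (int p))"
      by (simp add: \<eta>_def prod.distrib)
    then have "of_int \<eta> = char4 M * char8 M"
      using char4_prod[OF P] char8_prod[OF P] by (simp add: M_def)
    also have "\<dots> = 1"
      using \<open>M mod 8 = 3\<close> \<open>M mod 4 = 3\<close> \<open>odd M\<close> by (simp add: char4_def char8_def)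
    finally show ?thesis by simp
  next
    case False
    then have "M mod 8 = 1 \<or> M mod 8 = 2 \<or> M mod 8 = 5 \<or> M mod 8 = 6"
      using N_eq that mod8 by (auto simp: c_def split: if_splits)
    then have "M mod 4 = 1" using \<open>odd M\<close> by presburger
    have "of_int \<eta> = char4 M" using char4_prod[OF P] False by (simp add: M_def \<eta>_def \<sigma>_def)
    also have "\<dots> = 1" using \<open>M mod 4 = 1\<close> \<open>odd M\<close> by (simp add: char4_def)
    finally show ?thesis by simp
  qed
  obtain q where q: "prime q" "q mod 4 = 1" "Legendre 2 (int q) = \<eta>"
    "\<And>p. p \<in> P \<Longrightarrow> Legendre (int q) (int p) = \<sigma> p \<and> Legendre (int p) (int q) = \<sigma> p"
    using prime_with_prescribed_Legendre[where P = P and \<sigma> = \<sigma> and \<eta> = \<eta>] P \<sigma> \<eta> by blast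
  have q2: "2 < q" using q prime_ge_2_nat[of q] by (cases "q = 2") auto
  obtain z t w where ztw: "w \<noteq> 0" "int N * w\<^sup>2 = z\<^sup>2 + int (c * q) * t\<^sup>2"
  proof (rule isotropic_small_solution_prime[OF N q(1) q2])
    show "c \<in> {1, 2}" by (simp add: c_def)
    show "c = 2 \<longrightarrow> odd N" unfolding c_def by presburger
    show "Legendre (- int (c * q)) (int p) = 1" if "p \<in> prime_factors N - {2}" for p
    proof -
      have p: "p \<in> P" "prime p" "2 < p" using that P(2)[of p] by (auto simp: P_def)
      have "- int (c * q) = (if c = 2 then -2 else -1) * int q" by (simp add: c_def)
      then have "Legendre (- int (c * q)) (int p) = \<sigma> p * Legendre (int q) (int p)"
        by (simp only: Legendre_mult[OF p(2,3)] \<sigma>_def) simp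
      then show ?thesis using q(4)[OF p(1)] \<sigma>[OF p(1)] by auto
    qed
    have M: "Legendre (int M) (int q) = \<eta>"
      unfolding M_def Legendre_prod[OF q(1) q2 P(1)] \<eta>_def using q(4) by simp
    show "Legendre (int N) (int q) = 1"
    proof (cases "even N")
      case True
      then have "int N = 2 * int M" using N_eq by simp
      then have "Legendre (int N) (int q) = Legendre 2 (int q) * Legendre (int M) (int q)"
        by (simp only: Legendre_mult[OF q(1) q2])
      then show ?thesis using M q(3) \<eta> by auto
    next
      case False
      then show ?thesis using M N_eq \<eta>_odd by simp
    qed
  qed
  obtain u v where uv: "int q = u\<^sup>2 + v\<^sup>2" using two_squares[OF q(1,2)] by blast
  have "\<exists>a b. int (c * q) = a\<^sup>2 + 0 * a * b + b\<^sup>2"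
  proof (cases "c = 2")
    case True
    then have "int (c * q) = (u + v)\<^sup>2 + 0 * (u + v) * (u - v) + (u - v)\<^sup>2"
      by (simp add: uv power2_sum power2_diff)
    then show ?thesis by blast
  next
    case False
    then have "c = 1" by (simp add: c_def split: if_splits)
    then have "int (c * q) = u\<^sup>2 + 0 * u * v + v\<^sup>2" by (simp add: uv)
    then show ?thesis by blast
  qed
  then obtain a b where "int (c * q) = a\<^sup>2 + 0 * a * b + b\<^sup>2" by blast
  from ternary_form_represents[OF _ ztw this] show ?thesis by simp
qed

lemma obtain_squarefree_part:
  assumes "0 < (n::nat)"
  obtains m s where "n = m * s\<^sup>2" "squarefree m"
  using that[OF squarefree_decompose[of n]] squarefree_squarefree_part[of n] assms by auto

lemma odd_square_mod_8: "odd s \<Longrightarrow> s\<^sup>2 mod 8 = (1::nat)"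
proof -
  assume "odd s"
  then obtain k where "s = 2 * k + 1" by (elim oddE)
  then have s: "s\<^sup>2 = 4 * (k * (k + 1)) + 1" by (simp add: power2_eq_square algebra_simps)
  have "even (k * (k + 1))" by simp
  then obtain b where "k * (k + 1) = 2 * b" by (elim evenE)
  then show ?thesis unfolding s by simp
qed

text \<open>Excluding 0 and 4 modulo 8 forces the square part to be odd; its square is 1 modulo 8,
  so the squarefree part stays in the class of n.\<close>

theorem three_squares:
  fixes n :: nat
  assumes "n mod 8 \<in> {1, 2, 3, 5, 6}"
  shows "\<exists>x y z :: int. int n = x\<^sup>2 + y\<^sup>2 + z\<^sup>2"
proof -
  have "0 < n" using assms by (intro Nat.gr0I) auto
  then obtain m s where ms: "n = m * s\<^sup>2" "squarefree m" by (rule obtain_squarefree_part)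
  have "odd s"
  proof
    assume "even s"
    then obtain k where "s = 2 * k" by (elim evenE)
    then have "n = 4 * (m * k\<^sup>2)" using ms by (simp add: power_mult_distrib)
    then have "4 dvd n" by simp
    then have "n mod 8 = 0 \<or> n mod 8 = 4" by presburger
    with assms show False by auto
  qed
  have "n mod 8 = m mod 8"
    using mod_mult_right_eq[of m "s\<^sup>2" 8] odd_square_mod_8[OF \<open>odd s\<close>] ms(1) by simp
  then obtain x y z :: int where "int m = x\<^sup>2 + y\<^sup>2 + z\<^sup>2"
    using three_squares_squarefree[OF ms(2)] assms by auto
  then have "int n = (x * int s)\<^sup>2 + (y * int s)\<^sup>2 + (z * int s)\<^sup>2"
    using ms(1) by (simp add: algebra_simps)
  then show ?thesis by blast
qed

section \<open>Ternary sums of triangular numbers\<close>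

lemma square_mod_4: "\<exists>k. (x::int)\<^sup>2 = 4 * k + (if even x then 0 else 1)"
proof (cases "even x")
  case True
  then obtain k where "x = 2 * k" by (elim evenE)
  then show ?thesis by (intro exI[of _ "k\<^sup>2"]) (simp add: power_mult_distrib)
next
  case False
  then obtain k where "x = 2 * k + 1" by (elim oddE)
  then show ?thesis by (intro exI[of _ "k\<^sup>2 + k"]) (simp add: power2_eq_square algebra_simps)
qed

lemma odd_square_triangle:
  assumes "odd (x::int)"
  shows "\<exists>m. x\<^sup>2 = 8 * int (triangle m) + 1"
proof -
  have tri: "2 * int (triangle m) = int m * (int m + 1)" for m
    by (induction m) (auto simp: algebra_simps)
  obtain k where k: "x = 2 * k + 1" using assms by (elim oddE)
  \<comment> \<open>\<open>k\<close> and \<open>- k - 1\<close> give the same product k(k + 1), and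
    one of them is nonnegative.\<close>
  define m where "m = nat (if 0 \<le> k then k else - k - 1)"
  have "int m * (int m + 1) = k * (k + 1)" by (auto simp: m_def algebra_simps)
  then have "2 * int (triangle m) = k * (k + 1)" by (simp add: tri)
  then have "x\<^sup>2 = 8 * int (triangle m) + 1" by (simp add: k power2_eq_square algebra_simps)
  then show ?thesis ..
qed

lemma triangle_3: "triangle (3 * x + 1) = 9 * triangle x + 1"
proof (induction x)
  case (Suc x)
  have "3 * Suc x + 1 = Suc (Suc (Suc (3 * x + 1)))" by simp
  then show ?case using Suc by (simp only: triangle_Suc) simp
qed simp

definition ternary :: "nat \<Rightarrow> nat \<Rightarrow> nat \<Rightarrow> nat \<Rightarrow> bool" where
  "ternary a b c n \<longleftrightarrow> (\<exists>x y z. n = a * triangle x + b * triangle y + c * triangle z)"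

lemma ternaryI:
  fixes x y z :: int
  assumes "odd x" "odd y" "odd z"
    and eq: "8 * int n + int a + int b + int c = int a * x\<^sup>2 + int b * y\<^sup>2 + int c * z\<^sup>2"
  shows "ternary a b c n"
proof -
  obtain k l m where "x\<^sup>2 = 8 * int (triangle k) + 1" "y\<^sup>2 = 8 * int (triangle l) + 1"
    "z\<^sup>2 = 8 * int (triangle m) + 1"
    using odd_square_triangle assms(1-3) by meson
  then have "8 * int n = 8 * int (a * triangle k + b * triangle l + c * triangle m)"
    using eq by (simp add: algebra_simps)
  then have "n = a * triangle k + b * triangle l + c * triangle m"
    by (simp only: mult_cancel_left of_nat_eq_iff) simp
  then show ?thesis unfolding ternary_def by blast
qed

lemma three_squares_3_mod_8:
  assumes "n mod 8 = 3"
  obtains x y z :: int where "int n = x\<^sup>2 + y\<^sup>2 + z\<^sup>2" "odd x" "odd y" "odd z"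
proof -
  obtain x y z :: int where xyz: "int n = x\<^sup>2 + y\<^sup>2 + z\<^sup>2" using three_squares[of n] assms by auto
  obtain k l m where klm: "x\<^sup>2 = 4 * k + (if even x then 0 else 1)" "y\<^sup>2 = 4 * l + (if even y then 0 else 1)"
    "z\<^sup>2 = 4 * m + (if even z then 0 else 1)"
    using square_mod_4 by metis
  have "int n mod 8 = 3" using assms by presburger
  then have "odd x \<and> odd y \<and> odd z" unfolding xyz klm by (auto split: if_splits; presburger)
  with xyz that show ?thesis by blast
qed

lemma three_squares_2_mod_4:
  assumes "n mod 4 = 2"
  obtains x y z :: int where "int n = x\<^sup>2 + y\<^sup>2 + z\<^sup>2" "odd x" "odd y" "even z"
proof -
  have "n mod 8 = 2 \<or> n mod 8 = 6" using assms by presburger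
  then obtain x y z :: int where xyz: "int n = x\<^sup>2 + y\<^sup>2 + z\<^sup>2" using three_squares[of n] by auto
  obtain k l m where klm: "x\<^sup>2 = 4 * k + (if even x then 0 else 1)" "y\<^sup>2 = 4 * l + (if even y then 0 else 1)"
    "z\<^sup>2 = 4 * m + (if even z then 0 else 1)"
    using square_mod_4 by metis
  have "int n mod 4 = 2" using assms by presburger
  then have "odd x \<and> odd y \<and> even z \<or> odd x \<and> even y \<and> odd z \<or> even x \<and> odd y \<and> odd z"
    unfolding xyz klm by (auto split: if_splits; presburger)
  then consider "odd x" "odd y" "even z" | "odd x" "odd z" "even y" | "odd y" "odd z" "even x" by blast
  then show ?thesis
    using that[of x y z] that[of x z y] that[of y z x] xyz by cases (simp_all add: add_ac)
qed

lemma three_squares_1_mod_4: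
  assumes "n mod 4 = 1"
  obtains x y z :: int where "int n = x\<^sup>2 + y\<^sup>2 + z\<^sup>2" "odd x" "even y" "even z"
proof -
  have "n mod 8 = 1 \<or> n mod 8 = 5" using assms by presburger
  then obtain x y z :: int where xyz: "int n = x\<^sup>2 + y\<^sup>2 + z\<^sup>2" using three_squares[of n] by auto
  obtain k l m where klm: "x\<^sup>2 = 4 * k + (if even x then 0 else 1)" "y\<^sup>2 = 4 * l + (if even y then 0 else 1)"
    "z\<^sup>2 = 4 * m + (if even z then 0 else 1)"
    using square_mod_4 by metis
  have "int n mod 4 = 1" using assms by presburger
  then have "odd x \<and> even y \<and> even z \<or> even x \<and> odd y \<and> even z \<or> even x \<and> even y \<and> odd z"
    unfolding xyz klm by (auto split: if_splits; presburger)
  then consider "odd x" "even y" "even z" | "odd y" "even x" "even z" | "odd z" "even x" "even y" by blast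
  then show ?thesis
    using that[of x y z] that[of y x z] that[of z x y] xyz by cases (simp_all add: add_ac)
qed

lemma ternary_1_1_1: "ternary 1 1 1 n"
proof -
  have "(8 * n + 3) mod 8 = 3" by presburger
  then obtain x y z :: int where "int (8 * n + 3) = x\<^sup>2 + y\<^sup>2 + z\<^sup>2" "odd x" "odd y" "odd z"
    by (rule three_squares_3_mod_8)
  then show ?thesis by (intro ternaryI[of x y z]) auto
qed

text \<open>Doubling: 8n + 4 = 2(4n + 2), where 2(x^2 + z^2) = (x + z)^2 + (x - z)^2 with both new
  roots odd.\<close>

lemma ternary_1_1_2: "ternary 1 1 2 n"
proof -
  have "(4 * n + 2) mod 4 = 2" by presburger
  then obtain x y z :: int where xyz: "int (4 * n + 2) = x\<^sup>2 + y\<^sup>2 + z\<^sup>2" "odd x" "odd y" "even z"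
    by (rule three_squares_2_mod_4)
  show ?thesis
  proof (rule ternaryI[of "x + z" "x - z" y])
    show "8 * int n + int 1 + int 1 + int 2 = int 1 * (x + z)\<^sup>2 + int 1 * (x - z)\<^sup>2 + int 2 * y\<^sup>2"
      using xyz(1) by (simp add: power2_sum power2_diff)
  qed (use xyz in auto)
qed

text \<open>The even root in 8n + 6 = x^2 + y^2 + z^2 is z = 2w, and w is odd by a comparison modulo
  8.\<close>

lemma ternary_1_1_4: "ternary 1 1 4 n"
proof -
  have "(8 * n + 6) mod 4 = 2" by presburger
  then obtain x y z :: int where xyz: "int (8 * n + 6) = x\<^sup>2 + y\<^sup>2 + z\<^sup>2" "odd x" "odd y" "even z"
    by (rule three_squares_2_mod_4)
  obtain w where w: "z = 2 * w" using xyz(4) by (elim evenE)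
  obtain k l where kl: "x\<^sup>2 = 8 * k + 1" "y\<^sup>2 = 8 * l + 1" using odd_square_triangle xyz(2,3) by meson
  have "4 * w\<^sup>2 = 4 * (2 * (int n - k - l) + 1)" using xyz(1) unfolding kl by (simp add: w power_mult_distrib)
  then have "w\<^sup>2 = 2 * (int n - k - l) + 1" by simp
  then have "odd (w\<^sup>2)" by simp
  then have "odd w" by simp
  then show ?thesis using xyz by (intro ternaryI[of x y w]) (auto simp: w power_mult_distrib)
qed

text \<open>The two even roots 2v, 2w satisfy 4(v^2 + w^2) = 2(v + w)^2 + 2(v - w)^2, and v + w is
  odd by a comparison modulo 8.\<close>

lemma ternary_1_2_2: "ternary 1 2 2 n"
proof -
  have "(8 * n + 5) mod 4 = 1" by presburger
  then obtain x y z :: int where xyz: "int (8 * n + 5) = x\<^sup>2 + y\<^sup>2 + z\<^sup>2" "odd x" "even y" "even z"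
    by (rule three_squares_1_mod_4)
  obtain v w where vw: "y = 2 * v" "z = 2 * w" using xyz(3,4) by (elim evenE)
  obtain k where k: "x\<^sup>2 = 8 * k + 1" using odd_square_triangle xyz(2) by meson
  have "4 * (v\<^sup>2 + w\<^sup>2) = 4 * (2 * (int n - k) + 1)"
    using xyz(1) unfolding k by (simp add: vw power_mult_distrib)
  then have "v\<^sup>2 + w\<^sup>2 = 2 * (int n - k) + 1" by simp
  then have "odd (v\<^sup>2 + w\<^sup>2)" by simp
  then have odd: "odd (v + w)" "odd (v - w)" by auto
  show ?thesis
  proof (rule ternaryI[of x "v + w" "v - w"])
    show "8 * int n + int 1 + int 2 + int 2 = int 1 * x\<^sup>2 + int 2 * (v + w)\<^sup>2 + int 2 * (v - w)\<^sup>2"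
      using xyz(1) by (simp add: vw power2_sum power2_diff power_mult_distrib)
  qed (use xyz odd in auto)
qed

text \<open>Write 2(8n + 7) = u^2 + v^2 + b^2 with u, v odd. If the sign of v is chosen such that 4
  divides u - v, then u = x + 2z and v = x - 2z give u^2 + v^2 = 2x^2 + 8z^2; with b = 2y the
  equation can be halved. Congruences make y and z odd.\<close>

lemma ternary_1_2_4: "ternary 1 2 4 n"
proof -
  have "(16 * n + 14) mod 4 = 2" by presburger
  then obtain u v b :: int where uvb: "int (16 * n + 14) = u\<^sup>2 + v\<^sup>2 + b\<^sup>2" "odd u" "odd v" "even b"
    by (rule three_squares_2_mod_4)
  obtain v' where v': "4 dvd u - v'" "v'\<^sup>2 = v\<^sup>2"
  proof (cases "4 dvd u - v")
    case False
    then have "4 dvd u - (- v)" using uvb(2,3) by presburger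
    then show ?thesis by (rule that) simp
  qed (use that in blast)
  obtain z where z: "u - v' = 4 * z" using v' by (elim dvdE)
  obtain y where y: "b = 2 * y" using uvb(4) by (elim evenE)
  define x where "x = u - 2 * z"
  have "u = x + 2 * z" "v' = x - 2 * z" using z by (simp_all add: x_def)
  then have "u\<^sup>2 + v\<^sup>2 = 2 * x\<^sup>2 + 8 * z\<^sup>2"
    unfolding v'(2)[symmetric] by (simp add: power2_sum power2_diff power_mult_distrib)
  then have eq: "8 * int n + 7 = x\<^sup>2 + 2 * y\<^sup>2 + 4 * z\<^sup>2"
    using uvb(1) by (simp add: y power_mult_distrib)
  have "odd x" using uvb(2) by (simp add: x_def)
  obtain i j where ij: "u\<^sup>2 = 8 * i + 1" "v\<^sup>2 = 8 * j + 1" using odd_square_triangle uvb(2,3) by meson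
  have "4 * y\<^sup>2 = 4 * (2 * (2 * int n + 1 - i - j) + 1)"
    using uvb(1) unfolding ij by (simp add: y power_mult_distrib)
  then have "y\<^sup>2 = 2 * (2 * int n + 1 - i - j) + 1" by simp
  then have "odd (y\<^sup>2)" by simp
  then have "odd y" by simp
  obtain k l where kl: "x\<^sup>2 = 8 * k + 1" "y\<^sup>2 = 8 * l + 1" using odd_square_triangle \<open>odd x\<close> \<open>odd y\<close> by meson
  have "4 * z\<^sup>2 = 4 * (2 * (int n - k - 2 * l) + 1)" using eq unfolding kl by simp
  then have "z\<^sup>2 = 2 * (int n - k - 2 * l) + 1" by simp
  then have "odd (z\<^sup>2)" by simp
  then have "odd z" by simp
  show ?thesis
    using eq \<open>odd x\<close> \<open>odd y\<close> \<open>odd z\<close> by (intro ternaryI[of x y z]) auto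
qed

section \<open>Ternary forms that involve divisibility by 3 and 5\<close>

lemma square_mod_3: "\<exists>k. (x::int)\<^sup>2 = 3 * k + (if 3 dvd x then 0 else 1)"
proof -
  define q where "q = x div 3"
  have "x = 3 * q \<or> x = 3 * q + 1 \<or> x = 3 * q + 2" unfolding q_def by presburger
  then show ?thesis
  proof (elim disjE)
    assume "x = 3 * q"
    then show ?thesis by (intro exI[of _ "3 * q\<^sup>2"]) (simp add: power_mult_distrib)
  next
    assume "x = 3 * q + 1"
    moreover from this have "\<not> 3 dvd x" by presburger
    ultimately show ?thesis by (intro exI[of _ "3 * q\<^sup>2 + 2 * q"]) (simp add: power2_eq_square algebra_simps)
  next
    assume "x = 3 * q + 2"
    moreover from this have "\<not> 3 dvd x" by presburger
    ultimately show ?thesis by (intro exI[of _ "3 * q\<^sup>2 + 4 * q + 1"]) (simp add: power2_eq_square algebra_simps)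
  qed
qed

lemma root_sign_mod_prime:
  fixes x y p :: int
  assumes "prime p" "p dvd x\<^sup>2 - y\<^sup>2"
  obtains y' where "y'\<^sup>2 = y\<^sup>2" "p dvd x - y'" "even y' \<longleftrightarrow> even y"
proof -
  have "p dvd (x - y) * (x - (- y))" using assms(2) by (simp add: power2_eq_square algebra_simps)
  then have "p dvd x - y \<or> p dvd x - (- y)" using assms(1) by (simp only: prime_dvd_mult_iff)
  then show ?thesis using that[of y] that[of "- y"] by auto
qed

text \<open>Three squares with sum divisible by 3 agree modulo 3, so the signs can be chosen to make
  a, b, c congruent modulo 3.\<close>

lemma ternary_1_2_3: "ternary 1 2 3 n"
proof -
  have "(12 * n + 9) mod 4 = 1" by presburger
  then obtain a b0 c0 :: int where abc: "int (12 * n + 9) = a\<^sup>2 + b0\<^sup>2 + c0\<^sup>2" "odd a" "even b0" "even c0"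
    by (rule three_squares_1_mod_4)
  obtain k l m where klm: "a\<^sup>2 = 3 * k + (if 3 dvd a then 0 else 1)" "b0\<^sup>2 = 3 * l + (if 3 dvd b0 then 0 else 1)"
    "c0\<^sup>2 = 3 * m + (if 3 dvd c0 then 0 else 1)"
    using square_mod_3 by metis
  have "3 dvd a\<^sup>2 - b0\<^sup>2 \<and> 3 dvd a\<^sup>2 - c0\<^sup>2"
    using abc(1) unfolding klm by (auto split: if_splits; presburger)
  then have d: "3 dvd a\<^sup>2 - b0\<^sup>2" "3 dvd a\<^sup>2 - c0\<^sup>2" by auto
  obtain b where b: "b\<^sup>2 = b0\<^sup>2" "3 dvd a - b" "even b"
    using root_sign_mod_prime[OF _ d(1)] abc(3) by auto
  obtain c where c: "c\<^sup>2 = c0\<^sup>2" "3 dvd a - c" "even c"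
    using root_sign_mod_prime[OF _ d(2)] abc(4) by auto
  obtain z where z: "a - b = 3 * z" using b(2) by (elim dvdE)
  obtain t where t: "a - c = 3 * t" using c(2) by (elim dvdE)
  \<comment> \<open>In other words x = (a + b - 2c)/3, y = (a + b + c)/3, z = (a - b)/3. These are
    orthogonal directions with squared lengths 6, 3, 2, which the weights 1, 2, 3 equalize to
    6.\<close>
  define x y where "x = 2 * t - z" and "y = a - z - t"
  have "9 * (x\<^sup>2 + 2 * y\<^sup>2 + 3 * z\<^sup>2) = 6 * (a\<^sup>2 + b\<^sup>2 + c\<^sup>2)"
  proof -
    have bc: "b = a - 3 * z" "c = a - 3 * t" using z t by simp_all
    show ?thesis unfolding x_def y_def bc by (simp add: power2_eq_square algebra_simps)
  qed
  then have eq: "8 * int n + 6 = x\<^sup>2 + 2 * y\<^sup>2 + 3 * z\<^sup>2" using abc(1) b(1) c(1) by simp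
  have "odd (3 * z)" "odd (3 * t)" unfolding z[symmetric] t[symmetric] using abc(2) b(3) c(3) by simp_all
  then have "odd z" "odd t" by simp_all
  then have "odd x" "odd y" using abc(2) by (simp_all add: x_def y_def)
  then show ?thesis using eq \<open>odd z\<close> by (intro ternaryI[of x y z]) auto
qed

text \<open>Squares prime to 5 are 1 or -1 modulo 5, and three such signs never sum to 0, so one
  root in 5(8n + 7) is divisible by 5. The sum of the other two squares is a multiple of 5 and can
  be divided in the Gaussian integers.\<close>

lemma ternary_1_1_5: "ternary 1 1 5 n"
proof -
  have "(40 * n + 35) mod 8 = 3" by presburger
  then obtain x y z :: int where xyz: "int (40 * n + 35) = x\<^sup>2 + y\<^sup>2 + z\<^sup>2" "odd x" "odd y" "odd z"
    by (rule three_squares_3_mod_8)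
  have square_mod_5: "\<exists>k. x\<^sup>2 = 5 * k \<and> 5 dvd x \<or> x\<^sup>2 = 5 * k + 1 \<or> x\<^sup>2 = 5 * k + 4" for x :: int
  proof -
    define q where "q = x div 5"
    have "x = 5 * q \<or> x = 5 * q + 1 \<or> x = 5 * q + 2 \<or> x = 5 * q + 3 \<or> x = 5 * q + 4"
      unfolding q_def by presburger
    moreover have "(5 * q)\<^sup>2 = 5 * (5 * q\<^sup>2)" "(5 * q + 1)\<^sup>2 = 5 * (5 * q\<^sup>2 + 2 * q) + 1"
      "(5 * q + 2)\<^sup>2 = 5 * (5 * q\<^sup>2 + 4 * q) + 4" "(5 * q + 3)\<^sup>2 = 5 * (5 * q\<^sup>2 + 6 * q + 1) + 4"
      "(5 * q + 4)\<^sup>2 = 5 * (5 * q\<^sup>2 + 8 * q + 3) + 1"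
      by (simp_all add: power2_eq_square algebra_simps)
    ultimately show ?thesis by (metis dvd_triv_left)
  qed
  obtain k where k: "x\<^sup>2 = 5 * k \<and> 5 dvd x \<or> x\<^sup>2 = 5 * k + 1 \<or> x\<^sup>2 = 5 * k + 4"
    using square_mod_5[of x] by blast
  obtain l where l: "y\<^sup>2 = 5 * l \<and> 5 dvd y \<or> y\<^sup>2 = 5 * l + 1 \<or> y\<^sup>2 = 5 * l + 4"
    using square_mod_5[of y] by blast
  obtain m where m: "z\<^sup>2 = 5 * m \<and> 5 dvd z \<or> z\<^sup>2 = 5 * m + 1 \<or> z\<^sup>2 = 5 * m + 4"
    using square_mod_5[of z] by blast
  have "5 dvd x \<or> 5 dvd y \<or> 5 dvd z"
  proof (rule ccontr)
    assume "\<not> ?thesis"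
    then have "x\<^sup>2 = 5 * k + 1 \<or> x\<^sup>2 = 5 * k + 4" "y\<^sup>2 = 5 * l + 1 \<or> y\<^sup>2 = 5 * l + 4"
      "z\<^sup>2 = 5 * m + 1 \<or> z\<^sup>2 = 5 * m + 4" using k l m by blast+
    moreover have "x\<^sup>2 + y\<^sup>2 + z\<^sup>2 = 5 * (8 * int n + 7)" using xyz(1) by simp
    ultimately show False by (elim disjE; (simp only:, presburger))
  qed
  then consider "5 dvd z" | "5 dvd y" | "5 dvd x" by blast
  then obtain a b c where abc: "int (40 * n + 35) = a\<^sup>2 + b\<^sup>2 + c\<^sup>2" "odd a" "odd b" "odd c" "5 dvd c"
  proof cases
    case 1
    then show ?thesis using that[of x y z] xyz by blast
  next
    case 2
    then show ?thesis using that[of x z y] xyz by (simp add: add_ac)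
  next
    case 3
    then show ?thesis using that[of y z x] xyz by (simp add: add_ac)
  qed
  obtain w where w: "c = 5 * w" using abc(5) by (elim dvdE)
  have "a\<^sup>2 - (2 * b)\<^sup>2 = 5 * (8 * int n + 7 - 5 * w\<^sup>2 - b\<^sup>2)"
    using abc(1) by (simp add: w power_mult_distrib)
  then have "5 dvd a\<^sup>2 - (2 * b)\<^sup>2" by (rule dvdI)
  then obtain b' where b': "b'\<^sup>2 = (2 * b)\<^sup>2" "5 dvd a - b'" "even b' \<longleftrightarrow> even (2 * b)"
    using root_sign_mod_prime[of 5 a "2 * b"] by auto
  then obtain d where d: "b' = 2 * d" by (auto elim: evenE)
  then have "d\<^sup>2 = b\<^sup>2" using b'(1) by (simp add: power_mult_distrib)
  then have "odd d" using abc(3) by (metis even_power pos2)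
  obtain v where v: "a - 2 * d = 5 * v" using b'(2) d by (auto elim: dvdE)
  \<comment> \<open>Division by 2 + i: \<open>a = 2 * u + v\<close> and
    \<open>d = u - 2 * v\<close>, that is, a + di = (2 + i)(u - vi).\<close>
  define u where "u = 2 * v + d"
  have a: "a = 5 * v + 2 * d" using v by simp
  have "odd v" using abc(2) a by simp
  have "odd u" using \<open>odd d\<close> by (simp add: u_def)
  have "a\<^sup>2 + d\<^sup>2 = 5 * (u\<^sup>2 + v\<^sup>2)" unfolding a u_def by (simp add: power2_eq_square algebra_simps)
  then have "8 * int n + 7 = u\<^sup>2 + v\<^sup>2 + 5 * w\<^sup>2"
    using abc(1) \<open>d\<^sup>2 = b\<^sup>2\<close> by (simp add: w power_mult_distrib)
  then show ?thesis
    using \<open>odd u\<close> \<open>odd v\<close> abc(4) by (intro ternaryI[of u v w]) (auto simp: w)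
qed

text \<open>With (q/p) = (-1/p) for p dividing N, -q is a square modulo N, and (N/q) is the product
  of the (-1/p), which is 1 because N mod 4 = 1. The further condition (3/q) = 1 gives q = u^2 +
  3v^2, a value of the binary form at (u - v, 2v).\<close>

lemma eisenstein_form_represents_squarefree:
  fixes N :: nat
  assumes N: "squarefree N" and "N mod 4 = 1" "\<not> 3 dvd N"
  shows "\<exists>x y z :: int. int N = x\<^sup>2 + y\<^sup>2 + 1 * y * z + z\<^sup>2"
proof -
  define P where "P = prime_factors N"
  have N_eq: "\<Prod>P = N" by (simp add: P_def prod_prime_factors_squarefree[OF N])
  have "odd N" using assms(2) by presburger
  then have "2 \<notin> P" by (auto simp: P_def prime_factors_dvd)
  have "3 \<notin> P" using assms(3) by (auto simp: P_def prime_factors_dvd)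
  have P: "finite P" "\<And>p. p \<in> P \<Longrightarrow> prime p \<and> 2 < p"
  proof -
    fix p assume "p \<in> P"
    then have "prime p" "p \<noteq> 2" using \<open>2 \<notin> P\<close> by (auto simp: P_def)
    then show "prime p \<and> 2 < p" using prime_ge_2_nat[of p] by simp
  qed (simp add: P_def)
  \<comment> \<open>The sign 1 at 3 makes -3 a square modulo q. If 3 divided N, it would conflict
    with the sign (-1/3) = -1 wanted there.\<close>
  define \<sigma> where "\<sigma> = (\<lambda>p::nat. if p = 3 then 1 else Legendre (-1) (int p))"
  have \<sigma>: "\<sigma> p \<in> {-1, 1}" if "prime p \<and> 2 < p" for p
    using that Legendre_minus_one[of p] by (simp add: \<sigma>_def)
  have P3: "prime p \<and> 2 < p" if "p \<in> insert 3 P" for p using that P(2) by auto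
  obtain q where q: "prime q" "q mod 4 = 1"
    "\<And>p. p \<in> insert 3 P \<Longrightarrow> Legendre (int q) (int p) = \<sigma> p \<and> Legendre (int p) (int q) = \<sigma> p"
  proof (rule prime_with_prescribed_Legendre[of "insert 3 P" \<sigma> 1])
    show "finite (insert 3 P)" using P(1) by simp
    show "prime p \<and> 2 < p" "\<sigma> p \<in> {-1, 1}" if "p \<in> insert 3 P" for p
      using P3[OF that] \<sigma> by blast+
    show "(1::int) \<in> {-1, 1}" by simp
  qed (rule that)
  have q2: "2 < q" using q prime_ge_2_nat[of q] by (cases "q = 2") auto
  have q3: "3 < q" using q(2) q2 by (cases "q = 3") auto
  have "Legendre (int 3) (int q) = 1" using q(3)[of 3] by (simp add: \<sigma>_def)
  then have "Legendre (-1 * 3) (int q) = 1"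
    using Legendre_mult[OF q(1) q2, of "-1" 3] Legendre_minus_one[OF q(1) q2] q(2) by simp
  then have "Legendre (-3) (int q) = 1" by simp
  then obtain u v :: int where uv: "int q = u\<^sup>2 + 3 * v\<^sup>2"
    using square_plus_three_squares[OF q(1) q3] by blast
  have \<sigma>P: "\<sigma> p = Legendre (-1) (int p)" if "p \<in> P" for p using that \<open>3 \<notin> P\<close> by (auto simp: \<sigma>_def)
  obtain z t w :: int where ztw: "w \<noteq> 0" "int N * w\<^sup>2 = z\<^sup>2 + int (1 * q) * t\<^sup>2"
  proof (rule isotropic_small_solution_prime[OF N q(1) q2])
    show "Legendre (- int (1 * q)) (int p) = 1" if "p \<in> prime_factors N - {2}" for p
    proof -
      have p: "p \<in> P" "prime p" "2 < p" using that P(2)[of p] by (auto simp: P_def)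
      have "Legendre (-1 * int q) (int p) = \<sigma> p * \<sigma> p"
        unfolding Legendre_mult[OF p(2,3)] using q(3)[of p] p(1) \<sigma>P[OF p(1)] by simp
      then show ?thesis using \<sigma>[of p] p by auto
    qed
    have "of_int (\<Prod>p\<in>P. Legendre (-1) (int p)) = char4 N" using char4_prod[OF P] N_eq by simp
    also have "\<dots> = 1" using assms(2) \<open>odd N\<close> by (simp add: char4_def)
    finally have "(\<Prod>p\<in>P. Legendre (-1) (int p)) = 1" by linarith
    moreover have "Legendre (int (\<Prod>P)) (int q) = (\<Prod>p\<in>P. Legendre (-1) (int p))"
      unfolding Legendre_prod[OF q(1) q2 P(1)] using q(3) \<sigma>P by simp
    ultimately show "Legendre (int N) (int q) = 1" unfolding N_eq by simp
  qed auto
  have "int (1 * q) = (u - v)\<^sup>2 + 1 * (u - v) * (2 * v) + (2 * v)\<^sup>2"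
    by (simp add: uv power2_eq_square algebra_simps)
  from ternary_form_represents[OF _ ztw this] show ?thesis by simp
qed

text \<open>The form is symmetric in y, z and -(y + z), whose sum is 0, so one of the three is even;
  halving it completes the square over the integers.\<close>

lemma eisenstein_form_diagonal: "\<exists>a b :: int. y\<^sup>2 + 1 * y * z + z\<^sup>2 = a\<^sup>2 + 3 * b\<^sup>2"
proof -
  consider "even y" | "even z" | "even (y + z)" by auto
  then show ?thesis
  proof cases
    case 1
    then obtain k where "y = 2 * k" by (elim evenE)
    then have "y\<^sup>2 + 1 * y * z + z\<^sup>2 = (z + k)\<^sup>2 + 3 * k\<^sup>2" by (simp add: power2_eq_square algebra_simps)
    then show ?thesis by blast
  next
    case 2
    then obtain k where "z = 2 * k" by (elim evenE)
    then have "y\<^sup>2 + 1 * y * z + z\<^sup>2 = (y + k)\<^sup>2 + 3 * k\<^sup>2" by (simp add: power2_eq_square algebra_simps)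
    then show ?thesis by blast
  next
    case 3
    then obtain k where "y + z = 2 * k" by (elim evenE)
    then have y: "y = 2 * k - z" by simp
    have "y\<^sup>2 + 1 * y * z + z\<^sup>2 = (z - k)\<^sup>2 + 3 * k\<^sup>2" unfolding y by (simp add: power2_eq_square algebra_simps)
    then show ?thesis by blast
  qed
qed

text \<open>The hypothesis keeps 3 from dividing 8n + 5. Modulo 4 the roots obtained are all odd, or
  else b is even and exactly one of x, a is odd; the two even roots are then replaced by odd
  ones.\<close>

lemma ternary_1_1_3:
  assumes "n mod 3 \<noteq> 2"
  shows "ternary 1 1 3 n"
proof -
  define N where "N = 8 * n + 5"
  have "0 < N" "\<not> 3 dvd N" using assms unfolding N_def by presburger+
  obtain m s where ms: "N = m * s\<^sup>2" "squarefree m" using obtain_squarefree_part[OF \<open>0 < N\<close>] .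
  have "odd N" by (simp add: N_def)
  then have "odd s" using ms by auto
  have "N mod 8 = m mod 8"
    using mod_mult_right_eq[of m "s\<^sup>2" 8] odd_square_mod_8[OF \<open>odd s\<close>] ms(1) by simp
  moreover have "N mod 8 = 5" by (simp add: N_def)
  ultimately have "m mod 4 = 1" by presburger
  moreover have "\<not> 3 dvd m" using \<open>\<not> 3 dvd N\<close> ms(1) by auto
  ultimately obtain x y z :: int where xyz: "int m = x\<^sup>2 + y\<^sup>2 + 1 * y * z + z\<^sup>2"
    using eisenstein_form_represents_squarefree[OF ms(2)] by blast
  obtain a b :: int where ab: "y\<^sup>2 + 1 * y * z + z\<^sup>2 = a\<^sup>2 + 3 * b\<^sup>2"
    using eisenstein_form_diagonal by blast
  have "int m = x\<^sup>2 + a\<^sup>2 + 3 * b\<^sup>2" using xyz ab by linarith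
  then have "int N = (x * int s)\<^sup>2 + (a * int s)\<^sup>2 + 3 * (b * int s)\<^sup>2"
    using ms(1) by (simp add: algebra_simps)
  then obtain x a b :: int where eq: "8 * int n + 5 = x\<^sup>2 + a\<^sup>2 + 3 * b\<^sup>2"
    by (auto simp: N_def)
  obtain i j k where ijk: "x\<^sup>2 = 4 * i + (if even x then 0 else 1)" "a\<^sup>2 = 4 * j + (if even a then 0 else 1)"
    "b\<^sup>2 = 4 * k + (if even b then 0 else 1)"
    using square_mod_4 by metis
  have "odd x \<and> odd a \<and> odd b \<or> odd x \<and> even a \<and> even b \<or> even x \<and> odd a \<and> even b"
    using eq unfolding ijk by (auto split: if_splits; presburger)
  then consider "odd x" "odd a" "odd b"
    | x' a' where "odd x'" "even a'" "even b" "x\<^sup>2 + a\<^sup>2 = x'\<^sup>2 + a'\<^sup>2"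
    using add.commute[of "x\<^sup>2" "a\<^sup>2"] by blast
  then show ?thesis
  proof cases
    case 1
    then show ?thesis using eq by (intro ternaryI[of x a b]) auto
  next
    case 2
    obtain c d where cd: "a' = 2 * c" "b = 2 * d" using 2 by (elim evenE)
    obtain i where i: "x'\<^sup>2 = 8 * i + 1" using odd_square_triangle 2(1) by meson
    have eq': "8 * int n + 5 = x'\<^sup>2 + (2 * c)\<^sup>2 + 3 * (2 * d)\<^sup>2" using eq 2(4) by (simp add: cd)
    then have "4 * (c\<^sup>2 + 3 * d\<^sup>2) = 4 * (2 * (int n - i) + 1)"
      unfolding i by (simp add: power_mult_distrib)
    then have "c\<^sup>2 + 3 * d\<^sup>2 = 2 * (int n - i) + 1" by simp
    then have "odd (c\<^sup>2 + 3 * d\<^sup>2)" by simp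
    then have odd: "odd (c + 3 * d)" "odd (c - d)" by auto
    \<comment> \<open>Multiplication of c + d sqrt(-3) by 1 - sqrt(-3), which has the same norm 4 as
      the factor 2.\<close>
    have "(c + 3 * d)\<^sup>2 + 3 * (c - d)\<^sup>2 = (2 * c)\<^sup>2 + 3 * (2 * d)\<^sup>2"
      by (simp add: power2_eq_square algebra_simps)
    then show ?thesis using eq' odd 2(1) by (intro ternaryI[of x' "c + 3 * d" "c - d"]) auto
  qed
qed

section \<open>The quaternary forms (1,1,3,d)\<close>

lemma represents_if_ternary:
  assumes "ternary a b c n"
  shows "represents a b c d n" "represents a b d c n"
proof -
  obtain x y z where *: "n = a * triangle x + b * triangle y + c * triangle z"
    using assms unfolding ternary_def by blast
  then have "n = a * triangle x + b * triangle y + c * triangle z + d * triangle 0"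
    "n = a * triangle x + b * triangle y + d * triangle 0 + c * triangle z" by simp_all
  then show "represents a b c d n" "represents a b d c n" unfolding represents_def by blast+
qed

lemma represents_1_1_3_3: "represents 1 1 3 3 n"
proof (induction n rule: less_induct)
  case (less n)
  show ?case
  proof (cases "n mod 3 = 2")
    case True
    define k where "k = n div 3"
    have n: "n = 3 * k + 2" using True unfolding k_def by presburger
    have "k < n" by (simp add: n)
    then have "represents 1 1 3 3 k" by (rule less.IH)
    then obtain x y z w where "k = 1 * triangle x + 1 * triangle y + 3 * triangle z + 3 * triangle w"
      unfolding represents_def by blast
    \<comment> \<open>Multiplied by 3, the coefficients 1, 1, 3, 3 become 3, 3, 9, 9; each
      \<open>9 * triangle z + 1\<close> is triangular again, so the two pairs change places.\<close>
    then have "n = 1 * triangle (3 * z + 1) + 1 * triangle (3 * w + 1) + 3 * triangle x + 3 * triangle y"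
      unfolding triangle_3 n by simp
    then show ?thesis unfolding represents_def by blast
  qed (intro represents_if_ternary ternary_1_1_3)
qed

lemma represents_1_1_3_6: "represents 1 1 3 6 n"
proof (cases "n mod 3 = 2")
  case True
  define k where "k = n div 3"
  have n: "n = 3 * k + 2" using True unfolding k_def by presburger
  obtain x y z where "k = 1 * triangle x + 2 * triangle y + 3 * triangle z"
    using ternary_1_2_3[of k] unfolding ternary_def by blast
  \<comment> \<open>The coefficients 1, 2, 3 become 3, 6, 9. One unit of the remainder 2 goes into
    \<open>triangle (3 * z + 1)\<close>, the other is \<open>triangle 1\<close>.\<close>
  then have "n = 1 * triangle (3 * z + 1) + 1 * triangle (3 * 0 + 1) + 3 * triangle x + 6 * triangle y"
    unfolding triangle_3 n by simp
  then show ?thesis unfolding represents_def by blast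
qed (intro represents_if_ternary ternary_1_1_3)

text \<open>Taking w = 1 shifts the residue modulo 3 by d. For d = 7 and d = 8 this leaves the bad
  class, and 2 and 5 are the only members of that class below d.\<close>

lemma represents_1_1_3_shift:
  assumes "(n - d) mod 3 \<noteq> 2 \<and> d \<le> n \<or> n mod 3 \<noteq> 2 \<or> n = 2 \<or> n = 5"
  shows "represents 1 1 3 d n"
proof -
  consider "(n - d) mod 3 \<noteq> 2" "d \<le> n" | "n mod 3 \<noteq> 2" | "n = 2" | "n = 5" using assms by blast
  then show ?thesis
  proof cases
    case 1
    obtain x y z where "n - d = 1 * triangle x + 1 * triangle y + 3 * triangle z"
      using ternary_1_1_3[OF 1(1)] unfolding ternary_def by blast
    then have "n = 1 * triangle x + 1 * triangle y + 3 * triangle z + d * triangle 1" using 1(2) by simp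
    then show ?thesis unfolding represents_def by blast
  next
    case 2
    then show ?thesis by (intro represents_if_ternary ternary_1_1_3)
  next
    case 3
    then have "n = 1 * triangle 1 + 1 * triangle 1 + 3 * triangle 0 + d * triangle 0" by simp
    then show ?thesis unfolding represents_def by blast
  next
    case 4
    then have "n = 1 * triangle 1 + 1 * triangle 1 + 3 * triangle 1 + d * triangle 0" by simp
    then show ?thesis unfolding represents_def by blast
  qed
qed

lemma represents_1_1_3:
  assumes "3 \<le> d" "d \<le> 8"
  shows "represents 1 1 3 d n"
proof -
  consider "d = 3" | "d = 4" | "d = 5" | "d = 6" | "d = 7" | "d = 8" using assms by linarith
  then show ?thesis
  proof cases
    case 1
    then show ?thesis using represents_1_1_3_3 by simp
  next
    case 2
    \<comment> \<open>The coefficient 3 receives the variable 0: (1,1,4) is universal alone, and so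
      is (1,1,5) for d = 5.\<close>
    then show ?thesis using represents_if_ternary(2)[OF ternary_1_1_4] by simp
  next
    case 3
    then show ?thesis using represents_if_ternary(2)[OF ternary_1_1_5] by simp
  next
    case 4
    then show ?thesis using represents_1_1_3_6 by simp
  next
    case 5
    show ?thesis unfolding 5
    proof (cases "7 \<le> n")
      case True
      then obtain m where n: "n = 7 + m" using le_Suc_ex by blast
      have "m mod 3 \<noteq> 2 \<or> (7 + m) mod 3 \<noteq> 2" by presburger
      then show "represents 1 1 3 7 n" unfolding n by (intro represents_1_1_3_shift) auto
    next
      case False
      then have "n mod 3 \<noteq> 2 \<or> n = 2 \<or> n = 5" by presburger
      then show "represents 1 1 3 7 n" by (intro represents_1_1_3_shift) auto
    qed
  next
    case 6
    show ?thesis unfolding 6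
    proof (cases "8 \<le> n")
      case True
      then obtain m where n: "n = 8 + m" using le_Suc_ex by blast
      have "m mod 3 \<noteq> 2 \<or> (8 + m) mod 3 \<noteq> 2" by presburger
      then show "represents 1 1 3 8 n" unfolding n by (intro represents_1_1_3_shift) auto
    next
      case False
      then have "n mod 3 \<noteq> 2 \<or> n = 2 \<or> n = 5" by presburger
      then show "represents 1 1 3 8 n" by (intro represents_1_1_3_shift) auto
    qed
  qed
qed

section \<open>Necessity: the first numbers missed by shorter forms\<close>

lemma triangle_small_values:
  "triangle x = 0 \<or> triangle x = 1 \<or> triangle x = 3 \<or> triangle x = 6 \<or> 10 \<le> triangle x"
proof -
  have "10 \<le> triangle (x + 4)" for x by (induction x) (simp_all add: numeral_eq_Suc)
  then have "10 \<le> triangle x" if "4 \<le> x" using that le_Suc_ex[of 4 x] by (auto simp: add.commute)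
  moreover have "x = 0 \<or> x = 1 \<or> x = 2 \<or> x = 3 \<or> 4 \<le> x" by linarith
  ultimately show ?thesis by (auto simp: numeral_eq_Suc)
qed

lemma multiple_zero_or_ge: "k * t = 0 \<or> k \<le> k * (t::nat)"
  by (cases t) auto

text \<open>Each coefficient is at most the least number missed by the preceding ones: the empty
  form misses 1, (1) misses 2, (1,1) misses 5, (1,2) misses 4, (1,1,3) misses 8. All of these are
  below 10, so only the triangular numbers 0, 1, 3, 6 matter.\<close>

lemma universal_imp:
  assumes "0 < a" "a \<le> b" "b \<le> c" "c \<le> d" and univ: "\<And>n. represents a b c d n"
  shows "a = 1 \<and> (b = 1 \<and> (c = 1 \<or> c = 2 \<or> c = 3 \<and> d \<le> 8 \<or> c = 4 \<or> c = 5) \<or> b = 2 \<and> (c = 2 \<or> c = 3 \<or> c = 4))"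
proof -
  have a: "a = 1"
  proof (rule ccontr)
    assume "a \<noteq> 1"
    obtain x y z w where "1 = a * triangle x + b * triangle y + c * triangle z + d * triangle w"
      using univ unfolding represents_def by blast
    then show False
      using multiple_zero_or_ge[of a "triangle x"] multiple_zero_or_ge[of b "triangle y"]
        multiple_zero_or_ge[of c "triangle z"] multiple_zero_or_ge[of d "triangle w"] assms(1-4) \<open>a \<noteq> 1\<close>
      by linarith
  qed
  have b: "b \<le> 2"
  proof (rule ccontr)
    assume "\<not> b \<le> 2"
    obtain x y z w where "2 = a * triangle x + b * triangle y + c * triangle z + d * triangle w"
      using univ unfolding represents_def by blast
    then show False
      using multiple_zero_or_ge[of b "triangle y"] triangle_small_values[of x]
        multiple_zero_or_ge[of c "triangle z"] multiple_zero_or_ge[of d "triangle w"] assms(3,4) \<open>\<not> b \<le> 2\<close>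
      unfolding a mult_1 by linarith
  qed
  show ?thesis
  proof (cases "b = 1")
    case True
    have "c \<le> 5"
    proof (rule ccontr)
      assume "\<not> c \<le> 5"
      obtain x y z w where "5 = a * triangle x + b * triangle y + c * triangle z + d * triangle w"
        using univ unfolding represents_def by blast
      then show False
        using triangle_small_values[of x] triangle_small_values[of y]
          multiple_zero_or_ge[of c "triangle z"] multiple_zero_or_ge[of d "triangle w"] assms(4) \<open>\<not> c \<le> 5\<close>
        unfolding a True mult_1 by linarith
    qed
    moreover have "d \<le> 8" if c: "c = 3"
    proof (rule ccontr)
      assume "\<not> d \<le> 8"
      obtain x y z w where "8 = a * triangle x + b * triangle y + c * triangle z + d * triangle w"
        using univ unfolding represents_def by blast
      then show False
        using triangle_small_values[of x] triangle_small_values[of y] triangle_small_values[of z]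
          multiple_zero_or_ge[of d "triangle w"] \<open>\<not> d \<le> 8\<close>
        unfolding a True c mult_1 by linarith
    qed
    ultimately show ?thesis using a True assms(1-4) by auto
  next
    case False
    then have b2: "b = 2" using b assms(1,2) by linarith
    have "c \<le> 4"
    proof (rule ccontr)
      assume "\<not> c \<le> 4"
      obtain x y z w where "4 = a * triangle x + b * triangle y + c * triangle z + d * triangle w"
        using univ unfolding represents_def by blast
      then show False
        using triangle_small_values[of x] triangle_small_values[of y]
          multiple_zero_or_ge[of c "triangle z"] multiple_zero_or_ge[of d "triangle w"] assms(4) \<open>\<not> c \<le> 4\<close>
        unfolding a b2 mult_1 by linarith
    qed
    then show ?thesis using a b2 assms(3) by auto
  qed
qed

theorem theorem1p2:
  "(\<forall>d::nat. 3 \<le> d \<and> d \<le> 8 \<longrightarrow> (\<forall>n. represents 1 1 3 d n)) \<and>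
   (\<forall>a b c d :: nat. 0 < a \<and> a \<le> b \<and> b \<le> c \<and> c \<le> d \<longrightarrow>
      ((\<forall>n. represents a b c d n) \<longleftrightarrow>
        (a, b, c, d) \<in>
          {(1, 1, 1, d), (1, 1, 2, d), (1, 1, 4, d), (1, 1, 5, d),
           (1, 2, 2, d), (1, 2, 3, d), (1, 2, 4, d),
           (1, 1, 3, 3), (1, 1, 3, 4), (1, 1, 3, 5),
           (1, 1, 3, 6), (1, 1, 3, 7), (1, 1, 3, 8)}))"
proof (rule conjI)
  show "\<forall>d::nat. 3 \<le> d \<and> d \<le> 8 \<longrightarrow> (\<forall>n. represents 1 1 3 d n)"
    using represents_1_1_3 by blast
next
  have ternary: "represents 1 1 1 d n" "represents 1 1 2 d n" "represents 1 1 4 d n" "represents 1 1 5 d n"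
    "represents 1 2 2 d n" "represents 1 2 3 d n" "represents 1 2 4 d n" for d n
    by (intro represents_if_ternary(1) ternary_1_1_1 ternary_1_1_2 ternary_1_1_4 ternary_1_1_5
        ternary_1_2_2 ternary_1_2_3 ternary_1_2_4)+
  show "\<forall>a b c d :: nat. 0 < a \<and> a \<le> b \<and> b \<le> c \<and> c \<le> d \<longrightarrow>
      ((\<forall>n. represents a b c d n) \<longleftrightarrow>
        (a, b, c, d) \<in>
          {(1, 1, 1, d), (1, 1, 2, d), (1, 1, 4, d), (1, 1, 5, d),
           (1, 2, 2, d), (1, 2, 3, d), (1, 2, 4, d),
           (1, 1, 3, 3), (1, 1, 3, 4), (1, 1, 3, 5),
           (1, 1, 3, 6), (1, 1, 3, 7), (1, 1, 3, 8)})"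
  proof (intro allI impI)
    fix a b c d :: nat
    assume abcd: "0 < a \<and> a \<le> b \<and> b \<le> c \<and> c \<le> d"
    let ?S = "{(1, 1, 1, d), (1, 1, 2, d), (1, 1, 4, d), (1, 1, 5, d),
           (1, 2, 2, d), (1, 2, 3, d), (1, 2, 4, d),
           (1, 1, 3, 3), (1, 1, 3, 4), (1, 1, 3, 5),
           (1, 1, 3, 6), (1, 1, 3, 7), (1, 1, 3, 8)} :: (nat \<times> nat \<times> nat \<times> nat) set"
    show "(\<forall>n. represents a b c d n) \<longleftrightarrow> (a, b, c, d) \<in> ?S"
    proof
      assume "\<forall>n. represents a b c d n"
      then have *: "a = 1 \<and> (b = 1 \<and> (c = 1 \<or> c = 2 \<or> c = 3 \<and> d \<le> 8 \<or> c = 4 \<or> c = 5) \<or> b = 2 \<and> (c = 2 \<or> c = 3 \<or> c = 4))"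
        using universal_imp abcd by blast
      moreover have "d = 3 \<or> d = 4 \<or> d = 5 \<or> d = 6 \<or> d = 7 \<or> d = 8" if "c = 3" "d \<le> 8"
        using that abcd by linarith
      ultimately show "(a, b, c, d) \<in> ?S" by auto
    next
      assume "(a, b, c, d) \<in> ?S"
      then have "(a, b, c) \<in> {(1, 1, 1), (1, 1, 2), (1, 1, 4), (1, 1, 5), (1, 2, 2), (1, 2, 3), (1, 2, 4)}
          \<or> a = 1 \<and> b = 1 \<and> c = 3 \<and> 3 \<le> d \<and> d \<le> 8"
        by auto
      then show "\<forall>n. represents a b c d n"
        using ternary represents_1_1_3 by auto
    qed
  qed
qed

end
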